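(* Let $A=\Bbbk Q/I$ be a special multiserial and monomial algebra and let $R$ be a minimal set of (zero) relations such that $I=\langle R\rangle$. Then $A$ is a UMP algebra if and only if for any zero relation $r\in R$ with length greater than two, there exists a path $u$ such that $t(u)=s(u)$ and $$R\cap\{\text{subpaths of } u^{(p)}:\ p\in\mathbb{Z}^+\}=\{r\}.$$
   Context: $\Bbbk$ is an algebraically closed field, $Q=(Q_0,Q_1,s,t)$ is a finite connected quiver, $I$ is an admissible ideal of $\Bbbk Q$. A zero relation is a path belonging to $I$. $A$ is monomial if $I$ is generated by paths; then $R$ is the minimal set of paths generating $I$. The length of a path is its number of arrows. $u^{(p)}$ is the composition of the cyclic path $u$ with itself $p$ times. $A$ is special multiserial if for every $\alpha\in Q_1$ there is at most one arrow $\beta$ with $\alpha\beta\notin I$ and at most one arrow $\gamma$ with $\gamma\alpha\notin I$ (non-composable products are $0$). For a path $\mathfrak m$ in $Q$, $\mathfrak m+I$ is a maximal path of $A$ if $\mathfrak m\notin I$ and $\alpha\mathfrak m\in I$, $\mathfrak m\alpha\in I$ for every arrow $\alpha\in Q_1$. $A$ is a UMP algebra if every arrow extends to a unique maximal path, i.e. for every arrow $a$ there is exactly one maximal path $\mathfrak m+I$ having a representative path of which $a$ is a subpath. *)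

theory Defs
  imports
    "HOL-Algebra.Ideal_Product"
    "HOL-Algebra.QuotRing"
    "HOL-Computational_Algebra.Polynomial"
    "HOL-Library.Poly_Mapping"
    "Graph_Theory.Graph_Theory"
begin

text \<open>
  A quiver is a digraph in the sense of \<open>pre_digraph\<close>, which allows loops and
  parallel arrows. A path is its start vertex together with its list of arrows in the order in
  which they are traversed; the vertex is needed to tell the trivial paths apart. The product
  of \<open>p\<close> and \<open>q\<close> is \<open>p\<close> followed by \<open>q\<close>.
\<close>

type_synonym ('v, 'e) qpath = "'v \<times> 'e list"

definition qpaths :: "('v, 'e) pre_digraph \<Rightarrow> ('v, 'e) qpath set" where
  "qpaths Q = {(v, es). \<exists>w. pre_digraph.awalk Q v es w}"

definition path_source :: "('v, 'e) qpath \<Rightarrow> 'v" where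
  "path_source p = fst p"

definition path_target :: "('v, 'e) pre_digraph \<Rightarrow> ('v, 'e) qpath \<Rightarrow> 'v" where
  "path_target Q p = pre_digraph.awlast Q (fst p) (snd p)"

definition path_length :: "('v, 'e) qpath \<Rightarrow> nat" where
  "path_length p = length (snd p)"

definition path_append :: "('v, 'e) qpath \<Rightarrow> ('v, 'e) qpath \<Rightarrow> ('v, 'e) qpath" where
  "path_append p q = (fst p, snd p @ snd q)"

definition arrow_path :: "('v, 'e) pre_digraph \<Rightarrow> 'e \<Rightarrow> ('v, 'e) qpath" where
  "arrow_path Q a = (tail Q a, [a])"

definition subpath :: "('v, 'e) pre_digraph \<Rightarrow> ('v, 'e) qpath \<Rightarrow> ('v, 'e) qpath \<Rightarrow> bool" where
  "subpath Q q p \<longleftrightarrow>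
     (\<exists>x\<in>qpaths Q. \<exists>y\<in>qpaths Q. q \<in> qpaths Q \<and>
        path_target Q x = path_source q \<and> path_target Q q = path_source y \<and>
        p = path_append x (path_append q y))"

definition cycle_power :: "('v, 'e) qpath \<Rightarrow> nat \<Rightarrow> ('v, 'e) qpath" where
  "cycle_power u n = (fst u, concat (replicate n (snd u)))"


text \<open>
  The path algebra consists of the finitely supported functions on paths. Its product is the
  bilinear extension of concatenation, where non-composable paths multiply to zero. The ring
  product on \<^typ>\<open>'a \<Rightarrow>\<^sub>0 'b\<close> is not used. Since the path algebra has a unit and
  contains the scalar multiples of it, its ring ideals are its algebra ideals.
\<close>

definition path_mult :: "('v, 'e) pre_digraph \<Rightarrow>
    (('v, 'e) qpath \<Rightarrow>\<^sub>0 'k::field) \<Rightarrow> (('v, 'e) qpath \<Rightarrow>\<^sub>0 'k) \<Rightarrow> (('v, 'e) qpath \<Rightarrow>\<^sub>0 'k)" where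
  "path_mult Q f g =
     (\<Sum>p\<in>Poly_Mapping.keys f. \<Sum>q\<in>Poly_Mapping.keys g.
        if path_target Q p = path_source q
        then Poly_Mapping.single (path_append p q) (Poly_Mapping.lookup f p * Poly_Mapping.lookup g q)
        else 0)"

definition path_algebra :: "('v, 'e) pre_digraph \<Rightarrow> (('v, 'e) qpath \<Rightarrow>\<^sub>0 'k::field) ring" where
  "path_algebra Q =
     \<lparr> carrier = {f. Poly_Mapping.keys f \<subseteq> qpaths Q},
       monoid.mult = path_mult Q,
       one = (\<Sum>v\<in>verts Q. Poly_Mapping.single (v, []) 1),
       zero = 0,
       add = (+) \<rparr>"

definition path_elem :: "('v, 'e) qpath \<Rightarrow> (('v, 'e) qpath \<Rightarrow>\<^sub>0 'k::field)" where
  "path_elem p = Poly_Mapping.single p 1"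

definition arrow_elem :: "('v, 'e) pre_digraph \<Rightarrow> 'e \<Rightarrow> (('v, 'e) qpath \<Rightarrow>\<^sub>0 'k::field)" where
  "arrow_elem Q a = path_elem (arrow_path Q a)"

definition path_ideal :: "('v, 'e) pre_digraph \<Rightarrow> ('v, 'e) qpath set \<Rightarrow> (('v, 'e) qpath \<Rightarrow>\<^sub>0 'k::field) set" where
  "path_ideal Q S = Idl\<^bsub>path_algebra Q\<^esub> (path_elem ` S)"

definition arrow_ideal :: "('v, 'e) pre_digraph \<Rightarrow> (('v, 'e) qpath \<Rightarrow>\<^sub>0 'k::field) set" where
  "arrow_ideal Q = Idl\<^bsub>path_algebra Q\<^esub> (arrow_elem Q ` arcs Q)"

primrec arrow_ideal_power :: "('v, 'e) pre_digraph \<Rightarrow> nat \<Rightarrow> (('v, 'e) qpath \<Rightarrow>\<^sub>0 'k::field) set" where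
  "arrow_ideal_power Q 0 = carrier (path_algebra Q)"
| "arrow_ideal_power Q (Suc n) = arrow_ideal_power Q n \<cdot>\<^bsub>path_algebra Q\<^esub> arrow_ideal Q"

definition admissible :: "('v, 'e) pre_digraph \<Rightarrow> (('v, 'e) qpath \<Rightarrow>\<^sub>0 'k::field) set \<Rightarrow> bool" where
  "admissible Q I \<longleftrightarrow> ideal I (path_algebra Q) \<and>
     (\<exists>m\<ge>2. arrow_ideal_power Q m \<subseteq> I) \<and> I \<subseteq> arrow_ideal_power Q 2"


text \<open>
  The following properties of \<open>A = kQ/I\<close> are stated in terms of the pair \<open>(Q, I)\<close>.
\<close>

definition monomial :: "('v, 'e) pre_digraph \<Rightarrow> (('v, 'e) qpath \<Rightarrow>\<^sub>0 'k::field) set \<Rightarrow> bool" where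
  "monomial Q I \<longleftrightarrow> (\<exists>S\<subseteq>qpaths Q. I = path_ideal Q S)"

definition minimal_zero_relations ::
    "('v, 'e) pre_digraph \<Rightarrow> (('v, 'e) qpath \<Rightarrow>\<^sub>0 'k::field) set \<Rightarrow> ('v, 'e) qpath set \<Rightarrow> bool" where
  "minimal_zero_relations Q I R \<longleftrightarrow>
     R \<subseteq> qpaths Q \<and> path_ideal Q R = I \<and> (\<forall>S. S \<subset> R \<longrightarrow> path_ideal Q S \<noteq> I)"

definition special_multiserial :: "('v, 'e) pre_digraph \<Rightarrow> (('v, 'e) qpath \<Rightarrow>\<^sub>0 'k::field) set \<Rightarrow> bool" where
  "special_multiserial Q I \<longleftrightarrow>
     (\<forall>a\<in>arcs Q.
        (\<exists>\<^sub>\<le>\<^sub>1b. b \<in> arcs Q \<and> arrow_elem Q a \<otimes>\<^bsub>path_algebra Q\<^esub> arrow_elem Q b \<notin> I) \<and>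
        (\<exists>\<^sub>\<le>\<^sub>1c. c \<in> arcs Q \<and> arrow_elem Q c \<otimes>\<^bsub>path_algebra Q\<^esub> arrow_elem Q a \<notin> I))"

text \<open>
  Maximal paths are elements of \<open>A\<close>, that is, cosets of \<open>I\<close>, so that uniqueness below
  is uniqueness of the coset and not of a representing path.
\<close>

definition maximal_paths ::
    "('v, 'e) pre_digraph \<Rightarrow> (('v, 'e) qpath \<Rightarrow>\<^sub>0 'k::field) set \<Rightarrow> (('v, 'e) qpath \<Rightarrow>\<^sub>0 'k) set set" where
  "maximal_paths Q I =
     {I +>\<^bsub>path_algebra Q\<^esub> path_elem m | m. m \<in> qpaths Q \<and> path_elem m \<notin> I \<and>
        (\<forall>a\<in>arcs Q. arrow_elem Q a \<otimes>\<^bsub>path_algebra Q\<^esub> path_elem m \<in> I \<and>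
                    path_elem m \<otimes>\<^bsub>path_algebra Q\<^esub> arrow_elem Q a \<in> I)}"

definition UMP :: "('v, 'e) pre_digraph \<Rightarrow> (('v, 'e) qpath \<Rightarrow>\<^sub>0 'k::field) set \<Rightarrow> bool" where
  "UMP Q I \<longleftrightarrow>
     (\<forall>a\<in>arcs Q. \<exists>!M. M \<in> maximal_paths Q I \<and>
        (\<exists>m\<in>qpaths Q. M = I +>\<^bsub>path_algebra Q\<^esub> path_elem m \<and> subpath Q (arrow_path Q a) m))"


subsection \<open>The path algebra is a ring\<close>

lemma path_mult_superset:
  fixes f g :: "('v, 'e) qpath \<Rightarrow>\<^sub>0 'k::field"
  assumes "finite A" "finite B" "Poly_Mapping.keys f \<subseteq> A" "Poly_Mapping.keys g \<subseteq> B"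
  shows "path_mult Q f g =
     (\<Sum>p\<in>A. \<Sum>q\<in>B. if path_target Q p = path_source q
        then Poly_Mapping.single (path_append p q) (Poly_Mapping.lookup f p * Poly_Mapping.lookup g q)
        else 0)"
proof -
  have "path_mult Q f g =
     (\<Sum>p\<in>Poly_Mapping.keys f. \<Sum>q\<in>B. if path_target Q p = path_source q
        then Poly_Mapping.single (path_append p q) (Poly_Mapping.lookup f p * Poly_Mapping.lookup g q)
        else 0)"
    unfolding path_mult_def
    by (intro sum.cong refl sum.mono_neutral_left) (use assms in \<open>auto simp: in_keys_iff\<close>)
  also have "\<dots> = (\<Sum>p\<in>A. \<Sum>q\<in>B. if path_target Q p = path_source q
        then Poly_Mapping.single (path_append p q) (Poly_Mapping.lookup f p * Poly_Mapping.lookup g q)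
        else 0)"
    by (intro sum.mono_neutral_left) (use assms in \<open>auto simp: in_keys_iff intro!: sum.neutral\<close>)
  finally show ?thesis .
qed

lemma path_mult_add_left:
  "path_mult Q (f1 + f2) g = path_mult Q f1 g + path_mult Q f2 g"
proof -
  let ?A = "Poly_Mapping.keys f1 \<union> Poly_Mapping.keys f2"
  let ?B = "Poly_Mapping.keys g"
  have eq: "path_mult Q f g =
     (\<Sum>p\<in>?A. \<Sum>q\<in>?B. if path_target Q p = path_source q
        then Poly_Mapping.single (path_append p q) (Poly_Mapping.lookup f p * Poly_Mapping.lookup g q)
        else 0)" if "Poly_Mapping.keys f \<subseteq> ?A" for f
    by (rule path_mult_superset) (use that in auto)
  show ?thesis
    using Poly_Mapping.keys_add[of f1 f2]
    by (subst (1 2 3) eq)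
       (auto simp: sum.distrib[symmetric] lookup_add distrib_right single_add intro!: sum.cong)
qed

lemma path_mult_add_right:
  "path_mult Q f (g1 + g2) = path_mult Q f g1 + path_mult Q f g2"
proof -
  let ?A = "Poly_Mapping.keys f"
  let ?B = "Poly_Mapping.keys g1 \<union> Poly_Mapping.keys g2"
  have eq: "path_mult Q f g =
     (\<Sum>p\<in>?A. \<Sum>q\<in>?B. if path_target Q p = path_source q
        then Poly_Mapping.single (path_append p q) (Poly_Mapping.lookup f p * Poly_Mapping.lookup g q)
        else 0)" if "Poly_Mapping.keys g \<subseteq> ?B" for g
    by (rule path_mult_superset) (use that in auto)
  show ?thesis
    using Poly_Mapping.keys_add[of g1 g2]
    by (subst (1 2 3) eq)
       (auto simp: sum.distrib[symmetric] lookup_add distrib_left single_add intro!: sum.cong)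
qed

lemma path_mult_zero [simp]: "path_mult Q 0 g = 0" "path_mult Q f 0 = 0"
  by (simp_all add: path_mult_def)

lemma path_mult_sum_left: "path_mult Q (\<Sum>i\<in>A. f i) g = (\<Sum>i\<in>A. path_mult Q (f i) g)"
  by (induction A rule: infinite_finite_induct) (auto simp: path_mult_add_left)

lemma path_mult_sum_right: "path_mult Q f (\<Sum>i\<in>A. g i) = (\<Sum>i\<in>A. path_mult Q f (g i))"
  by (induction A rule: infinite_finite_induct) (auto simp: path_mult_add_right)

lemma path_mult_single:
  "path_mult Q (Poly_Mapping.single p a) (Poly_Mapping.single q b) =
     (if path_target Q p = path_source q then Poly_Mapping.single (path_append p q) (a * b) else 0)"
  by (subst path_mult_superset[of "{p}" "{q}"]) auto

lemma poly_mapping_single_induct: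
  fixes f :: "'a \<Rightarrow>\<^sub>0 'b::comm_monoid_add"
  assumes "P 0" "\<And>p a. P (Poly_Mapping.single p a)" "\<And>f g. P f \<Longrightarrow> P g \<Longrightarrow> P (f + g)"
  shows "P f"
proof -
  have "P (\<Sum>p\<in>A. Poly_Mapping.single p (Poly_Mapping.lookup f p))" for A
    by (induction A rule: infinite_finite_induct) (auto intro: assms)
  moreover have "f = (\<Sum>p\<in>Poly_Mapping.keys f. Poly_Mapping.single p (Poly_Mapping.lookup f p))"
    by (rule poly_mapping_eqI)
       (auto simp: lookup_sum lookup_single when_def in_keys_iff)
  ultimately show ?thesis
    by metis
qed

lemma path_target_append:
  assumes "path_target Q p = path_source q"
  shows "path_target Q (path_append p q) = path_target Q q"
proof -
  have *: "pre_digraph.awlast Q v (xs @ ys) = pre_digraph.awlast Q (pre_digraph.awlast Q v xs) ys" for v xs ys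
    by (simp add: pre_digraph.awalk_verts_conv)
  show ?thesis
    using assms by (simp add: path_target_def path_append_def path_source_def *)
qed

lemma path_mult_assoc: "path_mult Q (path_mult Q f g) h = path_mult Q f (path_mult Q g h)"
proof (induction f rule: poly_mapping_single_induct)
  case (2 p a)
  show ?case
  proof (induction g rule: poly_mapping_single_induct)
    case (2 q b)
    show ?case
    proof (induction h rule: poly_mapping_single_induct)
      case (2 r c)
      have "path_source (path_append q r) = path_source q"
        "path_append (path_append p q) r = path_append p (path_append q r)"
        by (auto simp: path_source_def path_append_def)
      then show ?case
        by (auto simp: path_mult_single path_target_append mult.assoc)
    qed (auto simp: path_mult_add_right)
  qed (auto simp: path_mult_add_right path_mult_add_left)
qed (auto simp: path_mult_add_left)

lemma qpaths_ends:
  assumes "fin_digraph Q" "p \<in> qpaths Q"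
  shows "path_source p \<in> verts Q" "path_target Q p \<in> verts Q"
proof -
  interpret fin_digraph Q by fact
  show "path_source p \<in> verts Q" "path_target Q p \<in> verts Q"
    using assms by (auto simp: qpaths_def path_source_def path_target_def)
qed

lemma path_append_in_qpaths:
  assumes "fin_digraph Q" "p \<in> qpaths Q" "q \<in> qpaths Q" "path_target Q p = path_source q"
  shows "path_append p q \<in> qpaths Q"
proof -
  interpret fin_digraph Q by fact
  obtain v es w where p: "p = (v, es)" "awalk v es w"
    using assms by (auto simp: qpaths_def)
  obtain v' es' w' where q: "q = (v', es')" "awalk v' es' w'"
    using assms by (auto simp: qpaths_def)
  have "w = v'"
    using assms(4) p q by (auto simp: path_target_def path_source_def)
  then have "awalk v (es @ es') w'"
    using p q by auto
  then show ?thesis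
    using p q by (auto simp: qpaths_def path_append_def)
qed

lemma keys_sum_subset:
  assumes "\<And>i. i \<in> A \<Longrightarrow> Poly_Mapping.keys (h i) \<subseteq> S"
  shows "Poly_Mapping.keys (\<Sum>i\<in>A. h i) \<subseteq> S"
  using assms
proof (induction A rule: infinite_finite_induct)
  case (insert i A)
  have "Poly_Mapping.keys (h i + (\<Sum>j\<in>A. h j)) \<subseteq> Poly_Mapping.keys (h i) \<union> Poly_Mapping.keys (\<Sum>j\<in>A. h j)"
    by (rule Poly_Mapping.keys_add)
  also have "\<dots> \<subseteq> S"
    using insert by (intro Un_least) auto
  finally show ?case
    using insert by simp
qed simp_all

lemma path_mult_closed:
  assumes "fin_digraph Q" "Poly_Mapping.keys f \<subseteq> qpaths Q" "Poly_Mapping.keys g \<subseteq> qpaths Q"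
  shows "Poly_Mapping.keys (path_mult Q f g) \<subseteq> qpaths Q"
  unfolding path_mult_def
proof (intro keys_sum_subset)
  fix p q assume "p \<in> Poly_Mapping.keys f" "q \<in> Poly_Mapping.keys g"
  then have "p \<in> qpaths Q" "q \<in> qpaths Q"
    using assms by auto
  then show "Poly_Mapping.keys (if path_target Q p = path_source q
      then Poly_Mapping.single (path_append p q) (Poly_Mapping.lookup f p * Poly_Mapping.lookup g q)
      else 0) \<subseteq> qpaths Q"
    using path_append_in_qpaths[OF assms(1)] by simp
qed

lemma path_one_mult:
  assumes "fin_digraph Q" "Poly_Mapping.keys f \<subseteq> qpaths Q"
  shows "path_mult Q (\<Sum>v\<in>verts Q. Poly_Mapping.single (v, []) 1) f = f"
    and "path_mult Q f (\<Sum>v\<in>verts Q. Poly_Mapping.single (v, []) 1) = f"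
proof -
  interpret fin_digraph Q by fact
  let ?one = "\<Sum>v\<in>verts Q. Poly_Mapping.single (v, []) 1"
  have f: "f = (\<Sum>p\<in>Poly_Mapping.keys f. Poly_Mapping.single p (Poly_Mapping.lookup f p))"
    by (rule poly_mapping_eqI) (auto simp: lookup_sum lookup_single when_def in_keys_iff)
  have "path_mult Q ?one (Poly_Mapping.single p a) = Poly_Mapping.single p a"
    if "p \<in> qpaths Q" for p and a :: 'c
  proof -
    have "path_mult Q ?one (Poly_Mapping.single p a) =
        (\<Sum>v\<in>verts Q. if v = path_source p then Poly_Mapping.single p a else 0)"
      unfolding path_mult_sum_left path_mult_single
      by (intro sum.cong) (auto simp: path_target_def path_source_def path_append_def)
    then show ?thesis
      using qpaths_ends(1)[OF assms(1) that] by simp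
  qed
  then show "path_mult Q ?one f = f"
    using assms(2) by (subst (1 2) f) (auto simp: path_mult_sum_right intro!: sum.cong)
  have "path_mult Q (Poly_Mapping.single p a) ?one = Poly_Mapping.single p a"
    if "p \<in> qpaths Q" for p and a :: 'c
  proof -
    have "path_mult Q (Poly_Mapping.single p a) ?one =
        (\<Sum>v\<in>verts Q. if v = path_target Q p then Poly_Mapping.single p a else 0)"
      unfolding path_mult_sum_right path_mult_single
      by (intro sum.cong) (auto simp: path_target_def path_source_def path_append_def)
    then show ?thesis
      using qpaths_ends(2)[OF assms(1) that] by simp
  qed
  then show "path_mult Q f ?one = f"
    using assms(2) by (subst (1 2) f) (auto simp: path_mult_sum_left intro!: sum.cong)
qed

lemma path_one_closed:
  assumes "fin_digraph Q"
  shows "Poly_Mapping.keys (\<Sum>v\<in>verts Q. Poly_Mapping.single (v, []) (1::'k::field)) \<subseteq> qpaths Q"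
proof -
  interpret fin_digraph Q by fact
  show ?thesis
    by (intro keys_sum_subset) (auto simp: qpaths_def awalk_Nil_iff)
qed

theorem ring_path_algebra:
  assumes "fin_digraph Q"
  shows "ring (path_algebra Q :: (('v, 'e) qpath \<Rightarrow>\<^sub>0 'k::field) ring)"
proof (rule ringI)
  let ?R = "path_algebra Q :: (('v, 'e) qpath \<Rightarrow>\<^sub>0 'k) ring"
  show "abelian_group ?R"
  proof (rule abelian_groupI)
    fix x y assume "x \<in> carrier ?R" "y \<in> carrier ?R"
    then show "x \<oplus>\<^bsub>?R\<^esub> y \<in> carrier ?R"
      using Poly_Mapping.keys_add[of x y] by (auto simp: path_algebra_def)
  next
    fix x assume "x \<in> carrier ?R"
    then show "\<exists>y\<in>carrier ?R. y \<oplus>\<^bsub>?R\<^esub> x = \<zero>\<^bsub>?R\<^esub>"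
      by (intro bexI[of _ "- x"]) (auto simp: path_algebra_def in_keys_iff)
  qed (auto simp: path_algebra_def add_ac)
  show "monoid ?R"
  proof (rule monoidI)
    fix x y assume "x \<in> carrier ?R" "y \<in> carrier ?R"
    then show "x \<otimes>\<^bsub>?R\<^esub> y \<in> carrier ?R"
      using path_mult_closed[OF assms, of x y] by (simp add: path_algebra_def)
  next
    show "\<one>\<^bsub>?R\<^esub> \<in> carrier ?R"
      using path_one_closed[OF assms] by (simp add: path_algebra_def)
  qed (simp_all add: path_algebra_def path_mult_assoc path_one_mult assms)
qed (auto simp: path_algebra_def path_mult_add_left path_mult_add_right)

end

(*
Write T a b when ab is a nonzero product of arrows. Since A is special multiserial, T is a partial
injection on arrows, so a nonzero path is determined by its first arrow and its length, and
likewise by its last arrow and its length.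

If A is UMP and r = a m z is a relation with m nontrivial, the relation r is the only obstruction
to extending m z to the left and a m to the right. The maximal paths m z y and x a m share the
arrows of m, so they are equal, and u = x a is the wanted cycle: u m is nonzero, so a relation on
the periodic path u u u ... must reach across a copy of r, hence equals r.

Conversely, if two different maximal paths share an arrow, one of them sticks out to the left, which
produces a relation r of length greater than two through the shared arrow. Both maximal paths lie
on the periodic path of the cycle u for r, and r is the only relation there, so r is what stops them
on the left. Hence both start with r minus its first arrow, and one is a prefix of the other.
*)
theory Submission
  imports Defs "HOL-Library.Sublist"
begin

section \<open>Powers of cyclic words\<close>

lemma successively_power:
  assumes "u \<noteq> []" "successively P u" "P (last u) (hd u)"
  shows "successively P (concat (replicate p u))"
proof (induction p)
  case (Suc p)
  have "hd (concat (replicate p u)) = hd u" if "p \<noteq> 0"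
    using that assms(1) by (cases p) auto
  then show ?case
    using Suc assms by (cases p) (auto simp: successively_append_iff)
qed simp

lemma length_power: "length (concat (replicate p u)) = p * length u"
  by (induction p) auto

text \<open>The combinatorial core, with nonempty paths replaced by their arrow lists.
  \<open>antichain\<close> encodes minimality of the relations, \<open>right_unique\<close> and
  \<open>left_unique\<close> encode special multiseriality, and \<open>length_relation\<close> and
  \<open>long_words_zero\<close> encode the two inclusions of admissibility.\<close>

locale monomial_words =
  fixes A :: "'e set" and C :: "'e \<Rightarrow> 'e \<Rightarrow> bool" and R :: "'e list set"
  assumes composable_arrows: "C a b \<Longrightarrow> a \<in> A \<and> b \<in> A"
    and length_relation: "r \<in> R \<Longrightarrow> 2 \<le> length r"
    and relation_composable: "r \<in> R \<Longrightarrow> successively C r"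
    and antichain: "r \<in> R \<Longrightarrow> r' \<in> R \<Longrightarrow> sublist r r' \<Longrightarrow> r = r'"
    and right_unique: "C a b \<Longrightarrow> C a c \<Longrightarrow> [a, b] \<notin> R \<Longrightarrow> [a, c] \<notin> R \<Longrightarrow> b = c"
    and left_unique: "C b a \<Longrightarrow> C c a \<Longrightarrow> [b, a] \<notin> R \<Longrightarrow> [c, a] \<notin> R \<Longrightarrow> b = c"
    and long_words_zero:
      "\<exists>n. \<forall>w. set w \<subseteq> A \<and> successively C w \<and> n \<le> length w \<longrightarrow> (\<exists>r\<in>R. sublist r w)"
begin

definition zero_word :: "'e list \<Rightarrow> bool" where
  "zero_word w \<longleftrightarrow> (\<exists>r\<in>R. sublist r w)"

definition T :: "'e \<Rightarrow> 'e \<Rightarrow> bool" where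
  "T a b \<longleftrightarrow> C a b \<and> [a, b] \<notin> R"

definition nonzero :: "'e list \<Rightarrow> bool" where
  "nonzero w \<longleftrightarrow> w \<noteq> [] \<and> set w \<subseteq> A \<and> successively C w \<and> \<not> zero_word w"

definition maximal :: "'e list \<Rightarrow> bool" where
  "maximal w \<longleftrightarrow> nonzero w \<and> (\<forall>a. C a (hd w) \<longrightarrow> zero_word (a # w)) \<and>
     (\<forall>a. C (last w) a \<longrightarrow> zero_word (w @ [a]))"

definition cyclic :: "'e list \<Rightarrow> bool" where
  "cyclic u \<longleftrightarrow> u \<noteq> [] \<and> set u \<subseteq> A \<and> successively C u \<and> C (last u) (hd u)"

section \<open>Nonzero words as walks along \<open>T\<close>\<close>

lemma zero_mono: "zero_word v \<Longrightarrow> sublist v w \<Longrightarrow> zero_word w"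
  unfolding zero_word_def using sublist_order.order.trans by blast

lemma successively_T:
  assumes "successively C w" "\<And>a b. sublist [a, b] w \<Longrightarrow> [a, b] \<notin> R"
  shows "successively T w"
  using assms
proof (induction w rule: induct_list012)
  case (3 x y zs)
  have "[x, y] \<notin> R"
    by (rule 3(4)) (auto simp: sublist_Cons_right)
  moreover have "successively T (y # zs)"
    using 3 by (intro 3(2)) (auto simp: sublist_Cons_right)
  ultimately show ?case
    using 3 by (auto simp: T_def)
qed auto

lemma nonzero_successively_T: "nonzero w \<Longrightarrow> successively T w"
  by (rule successively_T) (auto simp: nonzero_def zero_word_def)

text \<open>A relation of length two inside \<open>r\<close> would equal \<open>r\<close> by
  \<open>antichain\<close>, which the length forbids.\<close>

lemma relation_successively_T:
  assumes "r \<in> R" "2 < length r"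
  shows "successively T r"
  using assms by (intro successively_T relation_composable) (auto dest: antichain)

text \<open>By \<open>right_unique\<close> each arrow has at most one successor under
  \<open>T\<close>, so two walks with the same first arrow agree until the shorter one ends.\<close>

lemma T_walks_comparable:
  assumes "successively T v" "successively T w" "v \<noteq> []" "w \<noteq> []" "hd v = hd w"
  shows "prefix v w \<or> prefix w v"
  using assms
proof (induction v arbitrary: w)
  case (Cons a v)
  then obtain w' where w: "w = a # w'"
    by (cases w) auto
  show ?case
  proof (cases "v = [] \<or> w' = []")
    case False
    then have "hd v = hd w'"
      using Cons.prems right_unique by (auto simp: w successively_Cons T_def)
    then show ?thesis
      using Cons.IH[of w'] Cons.prems False by (auto simp: w successively_Cons)
  qed (auto simp: w)
qed simp

text \<open>Mirror image, by \<open>left_unique\<close>. The shared arrow \<open>a\<close> is split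
  off so that \<open>v\<close> and \<open>w\<close> may be empty.\<close>

lemma T_walks_comparable_left:
  assumes "successively T (v @ [a])" "successively T (w @ [a])"
  shows "suffix v w \<or> suffix w v"
  using assms
proof (induction v arbitrary: w a rule: rev_induct)
  case (snoc b v)
  show ?case
  proof (cases w rule: rev_cases)
    case (snoc w' c)
    then have "c = b"
      using snoc.prems left_unique by (auto simp: successively_append_iff T_def)
    then show ?thesis
      using snoc.IH[of b w'] snoc.prems snoc by (auto simp: successively_append_iff)
  qed auto
qed simp

section \<open>Extension to maximal words\<close>

definition bound :: nat where
  "bound = (SOME n. \<forall>w. set w \<subseteq> A \<and> successively C w \<and> n \<le> length w \<longrightarrow> zero_word w)"

lemma nonzero_length: "nonzero w \<Longrightarrow> length w < bound"
  using someI_ex[OF long_words_zero[folded zero_word_def]] unfolding bound_def[symmetric]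
  by (auto simp: nonzero_def not_le[symmetric])

text \<open>Appending arrows as long as the word stays nonzero must stop, because nonzero words are
  shorter than \<open>bound\<close>; hence the induction on \<open>bound - length w\<close>.\<close>

lemma extend_right:
  assumes "nonzero w"
  obtains y where "nonzero (w @ y)" "\<And>a. C (last (w @ y)) a \<Longrightarrow> zero_word (w @ y @ [a])"
proof -
  have "\<exists>y. nonzero (w @ y) \<and> (\<forall>a. C (last (w @ y)) a \<longrightarrow> zero_word (w @ y @ [a]))"
    using assms
  proof (induction "bound - length w" arbitrary: w rule: less_induct)
    case less
    show ?case
    proof (cases "\<exists>a. C (last w) a \<and> \<not> zero_word (w @ [a])")
      case True
      then obtain a where a: "C (last w) a" "\<not> zero_word (w @ [a])" by blast
      then have "nonzero (w @ [a])"
        using less.prems composable_arrows by (auto simp: nonzero_def successively_append_iff)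
      moreover have "bound - length (w @ [a]) < bound - length w"
        using nonzero_length[OF less.prems] by simp
      ultimately obtain y where "nonzero ((w @ [a]) @ y)"
          "\<forall>b. C (last ((w @ [a]) @ y)) b \<longrightarrow> zero_word ((w @ [a]) @ y @ [b])"
        using less.hyps[of "w @ [a]"] by blast
      then show ?thesis
        by (intro exI[of _ "a # y"]) auto
    next
      case False
      with less.prems show ?thesis
        by (intro exI[of _ "[]"]) auto
    qed
  qed
  with that show ?thesis by blast
qed

lemma extend_left:
  assumes "nonzero w"
  obtains x where "nonzero (x @ w)" "\<And>a. C a (hd (x @ w)) \<Longrightarrow> zero_word (a # x @ w)"
proof -
  have "\<exists>x. nonzero (x @ w) \<and> (\<forall>a. C a (hd (x @ w)) \<longrightarrow> zero_word (a # x @ w))"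
    using assms
  proof (induction "bound - length w" arbitrary: w rule: less_induct)
    case less
    show ?case
    proof (cases "\<exists>a. C a (hd w) \<and> \<not> zero_word (a # w)")
      case True
      then obtain a where a: "C a (hd w)" "\<not> zero_word (a # w)" by blast
      then have "nonzero (a # w)"
        using less.prems composable_arrows by (auto simp: nonzero_def successively_Cons)
      moreover have "bound - length (a # w) < bound - length w"
        using nonzero_length[OF less.prems] by simp
      ultimately obtain x where "nonzero (x @ a # w)"
          "\<forall>b. C b (hd (x @ a # w)) \<longrightarrow> zero_word (b # x @ a # w)"
        using less.hyps[of "a # w"] by blast
      then show ?thesis
        by (intro exI[of _ "x @ [a]"]) auto
    next
      case False
      with less.prems show ?thesis
        by (intro exI[of _ "[]"]) auto
    qed
  qed
  with that show ?thesis by blast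
qed

text \<open>The left end remains blocked during the extension: a relation inside
  \<open>a # w\<close> is still inside \<open>a # w @ y\<close>.\<close>

lemma extend_right_maximal:
  assumes "nonzero w" "\<And>a. C a (hd w) \<Longrightarrow> zero_word (a # w)"
  obtains y where "maximal (w @ y)"
proof -
  obtain y where y: "nonzero (w @ y)" "\<And>a. C (last (w @ y)) a \<Longrightarrow> zero_word (w @ y @ [a])"
    using extend_right[OF assms(1)] by blast
  have "w \<noteq> []" using assms(1) by (simp add: nonzero_def)
  moreover have "sublist (a # w) (a # w @ y)" for a
    by (metis append_Cons prefix_imp_sublist prefixI)
  then have "zero_word (a # w @ y)" if "C a (hd w)" for a
    using zero_mono assms(2) that by blast
  ultimately have "maximal (w @ y)"
    using y by (auto simp: maximal_def)
  with that show ?thesis by blast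
qed

lemma extend_left_maximal:
  assumes "nonzero w" "\<And>a. C (last w) a \<Longrightarrow> zero_word (w @ [a])"
  obtains x where "maximal (x @ w)"
proof -
  obtain x where x: "nonzero (x @ w)" "\<And>a. C a (hd (x @ w)) \<Longrightarrow> zero_word (a # x @ w)"
    using extend_left[OF assms(1)] by blast
  have "w \<noteq> []" using assms(1) by (simp add: nonzero_def)
  moreover have "sublist (w @ [a]) (x @ w @ [a])" for a
    by (simp add: suffix_imp_sublist suffixI)
  then have "zero_word (x @ w @ [a])" if "C (last w) a" for a
    using zero_mono assms(2) that by blast
  ultimately have "maximal (x @ w)"
    using x by (auto simp: maximal_def)
  with that show ?thesis by blast
qed

lemma nonzero_extends_to_maximal:
  assumes "nonzero w"
  obtains v where "maximal v" "sublist w v"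
proof -
  obtain y where y: "nonzero (w @ y)" "\<And>a. C (last (w @ y)) a \<Longrightarrow> zero_word ((w @ y) @ [a])"
    using extend_right[OF assms] by auto
  obtain x where "maximal (x @ w @ y)"
    using extend_left_maximal[OF y] by blast
  with that show ?thesis by (meson sublist_appendI)
qed

lemma nonzero_arrow:
  assumes "a \<in> A"
  shows "nonzero [a]"
proof -
  have "\<not> sublist r [a]" if "r \<in> R" for r
    using sublist_length_le[of r "[a]"] length_relation[OF that] by auto
  with assms show ?thesis
    by (auto simp: nonzero_def zero_word_def)
qed

text \<open>If \<open>w\<close> stuck out of \<open>v\<close> on one side, then \<open>v\<close>
  together with the neighbouring arrow would be a nonzero word, contrary to maximality.\<close>

lemma maximal_sublist_eq:
  assumes "maximal v" "nonzero w" "sublist v w"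
  shows "v = w"
proof -
  obtain p s where w: "w = p @ v @ s"
    using assms(3) by (auto simp: sublist_def)
  have v: "v \<noteq> []" using assms(1) by (simp add: maximal_def nonzero_def)
  have "p = []"
  proof (rule ccontr)
    assume "p \<noteq> []"
    then obtain q b where p: "p = q @ [b]" by (metis rev_exhaust)
    then have "C b (hd v)"
      using assms(2) v by (auto simp: w nonzero_def successively_append_iff successively_Cons)
    then have "zero_word (b # v)" using assms(1) by (auto simp: maximal_def)
    moreover have "sublist (b # v) w"
      using sublist_appendI[of "b # v" q s] by (simp add: w p)
    ultimately show False using assms(2) zero_mono by (auto simp: nonzero_def)
  qed
  moreover have "s = []"
  proof (rule ccontr)
    assume "s \<noteq> []"
    then obtain t b where s: "s = b # t" by (cases s) auto
    then have "C (last v) b"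
      using assms(2) v by (auto simp: w nonzero_def successively_append_iff)
    then have "zero_word (v @ [b])" using assms(1) by (auto simp: maximal_def)
    moreover have "sublist (v @ [b]) w"
      using sublist_appendI[of "v @ [b]" p t] by (simp add: w s)
    ultimately show False using assms(2) zero_mono by (auto simp: nonzero_def)
  qed
  ultimately show ?thesis by (simp add: w)
qed

section \<open>Walks on the periodic word of a cycle\<close>

text \<open>From an arrow of \<open>u\<close> a walk has no choice but to run around the cycle. The
  right-hand word is a power of \<open>u\<close> with the part \<open>u1\<close> before
  \<open>hd w\<close> cut off.\<close>

lemma T_walk_prefix_power:
  assumes "u \<noteq> []" "successively T u" "T (last u) (hd u)"
    and "successively T w" "w \<noteq> []" "u = u1 @ hd w # u2" "length w \<le> p"
  shows "prefix w (hd w # u2 @ concat (replicate p u))"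
proof -
  have "successively T (concat (replicate (Suc p) u))"
    by (rule successively_power) (use assms in auto)
  then have "successively T (u1 @ hd w # u2 @ concat (replicate p u))"
    using assms(6) by (metis append.assoc append_Cons concat.simps(2) replicate_Suc)
  then have "successively T (hd w # u2 @ concat (replicate p u))"
    by (auto simp: successively_append_iff)
  from T_walks_comparable[OF assms(4) this assms(5)]
  consider "prefix w (hd w # u2 @ concat (replicate p u))"
    | "prefix (hd w # u2 @ concat (replicate p u)) w" by auto
  then show ?thesis
  proof cases
    \<comment> \<open>This case is contradictory: the periodic word is longer than \<open>p\<close>,
      since \<open>u\<close> is nonempty, and \<open>w\<close> is not.\<close>
    case 2
    have "p \<le> p * length u" using assms(1) by (cases u) auto
    with prefix_length_le[OF 2] assms(7) show ?thesis
      by (simp add: length_power)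
  qed
qed

text \<open>One shared arrow is enough: going back from \<open>a\<close> the walk cannot leave the
  cycle, so it starts on the cycle and then follows it.\<close>

lemma T_walk_in_power:
  assumes u: "u \<noteq> []" "successively T u" "T (last u) (hd u)"
    and w: "successively T w" "a \<in> set w" "a \<in> set u"
  shows "hd w \<in> set u" "\<exists>p>0. sublist w (concat (replicate p u))"
proof -
  \<comment> \<open>Every arrow of the cycle has a predecessor in the cycle, and
    \<open>left_unique\<close> makes it the only one.\<close>
  have pred: "c \<in> set u" if cb: "T c b" "b \<in> set u" for b c
  proof -
    obtain u1 u2 where u12: "u = u1 @ b # u2" using cb(2) by (meson split_list)
    have "\<exists>c'\<in>set u. T c' b"
    proof (cases u1 rule: rev_cases)
      \<comment> \<open>The first arrow of \<open>u\<close> is preceded by the last one, across the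
        junction of two copies.\<close>
      case Nil
      then show ?thesis using u u12 by (intro bexI[of _ "last u"]) auto
    next
      case (snoc v c')
      then show ?thesis using u(2) u12
        by (intro bexI[of _ c']) (auto simp: successively_append_iff)
    qed
    then show ?thesis using cb(1) left_unique by (auto simp: T_def)
  qed
  obtain x y where "w = x @ a # y" using w(2) by (meson split_list)
  then show hd: "hd w \<in> set u"
    using w(1,3)
  proof (induction x arbitrary: w)
    case (Cons c x)
    have "hd (x @ a # y) \<in> set u"
      using Cons by (intro Cons.IH) (auto simp: successively_Cons)
    moreover have "T c (hd (x @ a # y))"
      using Cons.prems by (auto simp: successively_Cons)
    ultimately show ?case using pred Cons.prems by auto
  qed auto
  obtain u1 u2 where u12: "u = u1 @ hd w # u2" using hd by (meson split_list)
  have "prefix w (hd w # u2 @ concat (replicate (length w) u))"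
    using T_walk_prefix_power[OF u w(1) _ u12, of "length w"] w(2) by fastforce
  then obtain z where z: "hd w # u2 @ concat (replicate (length w) u) = w @ z"
    by (auto simp: prefix_def)
  \<comment> \<open>The additional copy of \<open>u\<close> supplies \<open>u1\<close> and the piece
    from \<open>hd w\<close> to the end of the cycle.\<close>
  have "concat (replicate (Suc (length w)) u)
      = u1 @ (hd w # u2 @ concat (replicate (length w) u))"
    by (subst u12, simp only: replicate_Suc concat.simps) (metis u12 append.assoc append_Cons)
  also have "\<dots> = u1 @ w @ z" by (simp only: z)
  finally show "\<exists>p>0. sublist w (concat (replicate p u))"
    by (intro exI[of _ "Suc (length w)"]) (auto simp del: replicate_Suc)
qed

section \<open>From unique maximal words to cycles\<close>

lemma cyclic_power_if_unique_maximal: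
  assumes unique: "\<And>a v w. a \<in> A \<Longrightarrow> maximal v \<Longrightarrow> maximal w \<Longrightarrow> a \<in> set v \<Longrightarrow> a \<in> set w \<Longrightarrow> v = w"
    and r: "r \<in> R" "2 < length r"
  shows "\<exists>u. cyclic u \<and> {r' \<in> R. \<exists>p>0. sublist r' (concat (replicate p u))} = {r}"
proof -
  \<comment> \<open>Length greater than two makes \<open>m\<close> nonempty, so that the two maximal
    words built below share an arrow.\<close>
  obtain a m z where r_eq: "r = a # m @ [z]" and m: "m \<noteq> []"
  proof -
    obtain a s where "r = a # s" using r(2) by (cases r) auto
    moreover from this obtain m z where "s = m @ [z]" using r(2) by (cases s rule: rev_cases) auto
    ultimately show ?thesis using that r(2) by auto
  qed
  have rT: "successively T r" by (rule relation_successively_T[OF r])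
  have rC: "successively C r" by (rule relation_composable[OF r(1)])
  \<comment> \<open>Every arrow of \<open>r\<close> has a neighbour in \<open>r\<close>, and
    composability with it places the arrow in \<open>A\<close>.\<close>
  have rA: "set r \<subseteq> A"
  proof
    fix b assume "b \<in> set r"
    then obtain x y where "r = x @ b # y" by (meson split_list)
    with rC r(2) show "b \<in> A"
      by (cases x rule: rev_cases; cases y)
         (auto simp: successively_append_iff successively_Cons dest: composable_arrows)
  qed
  \<comment> \<open>A relation inside a proper part of \<open>r\<close> would contradict
    \<open>antichain\<close>.\<close>
  have proper: "nonzero v" if v: "sublist v r" "v \<noteq> r" "v \<noteq> []" for v
  proof -
    obtain x y where "r = x @ v @ y" using v(1) by (auto simp: sublist_def)
    moreover have "\<not> zero_word v"
      using antichain[OF _ r(1)] v sublist_order.order.trans sublist_order.order.antisym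
      unfolding zero_word_def by metis
    ultimately show ?thesis
      using v(3) rA rC by (auto simp: nonzero_def successively_append_iff)
  qed
  have mz: "nonzero (m @ [z])" by (rule proper) (auto simp: r_eq sublist_Cons_right)
  have am: "nonzero (a # m)"
  proof (rule proper)
    show "sublist (a # m) r" using sublist_appendI[of "a # m" "[]" "[z]"] by (simp add: r_eq)
  qed (auto simp: r_eq)
  have zr: "zero_word r" using r(1) by (auto simp: zero_word_def)
  have T_am: "T a (hd m)" "T (last m) z"
    using rT m by (auto simp: r_eq successively_Cons successively_append_iff)
  \<comment> \<open>Either \<open>b\<close> forms a relation of length two with \<open>hd m\<close>,
    or \<open>b = a\<close> by \<open>left_unique\<close> and the word is \<open>r\<close>
    itself.\<close>
  have "zero_word (b # m @ [z])" if "C b (hd (m @ [z]))" for b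
  proof (cases "[b, hd m] \<in> R")
    case True
    then have "zero_word [b, hd m]" by (auto simp: zero_word_def)
    moreover have "sublist [b, hd m] (b # m @ [z])"
      using m by (cases m) (auto simp: sublist_Cons_right)
    ultimately show ?thesis by (rule zero_mono)
  next
    case False
    then have "b = a" using left_unique[of b "hd m" a] T_am that m by (auto simp: T_def)
    then show ?thesis using zr by (simp add: r_eq)
  qed
  with mz obtain y where y: "maximal ((m @ [z]) @ y)"
    using extend_right_maximal by metis
  have "zero_word ((a # m) @ [b])" if "C (last (a # m)) b" for b
  proof (cases "[last m, b] \<in> R")
    case True
    then have "zero_word [last m, b]" by (auto simp: zero_word_def)
    moreover have "(a # m) @ [b] = (a # butlast m) @ [last m, b] @ []"
      using m by simp
    then have "sublist [last m, b] ((a # m) @ [b])"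
      unfolding sublist_def by blast
    ultimately show ?thesis by (rule zero_mono)
  next
    case False
    then have "b = z" using right_unique[of "last m" b z] T_am that m by (auto simp: T_def)
    then show ?thesis using zr by (simp add: r_eq)
  qed
  with am obtain x where x: "maximal (x @ a # m)"
    using extend_left_maximal by metis
  have eq: "(m @ [z]) @ y = x @ a # m"
  proof (rule unique[OF _ y x, of "hd m"])
    show "hd m \<in> A" using mz hd_in_set[OF m] by (auto simp: nonzero_def)
  qed (use m in auto)
  define u where "u = x @ [a]"
  \<comment> \<open>The same maximal word read in two ways: it ends in \<open>a # m\<close> and
    begins with \<open>m @ [z]\<close>.\<close>
  have um: "u @ m = m @ z # y" using eq by (simp add: u_def)
  have nz: "nonzero (u @ m)" using x by (simp add: maximal_def u_def)
  have hd_u: "hd u = hd m"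
  proof -
    have "hd (u @ m) = hd (m @ z # y)" by (simp only: um)
    then show ?thesis using m by (cases x) (auto simp: u_def)
  qed
  have u0: "u \<noteq> []" by (simp add: u_def)
  \<comment> \<open>In the nonzero word \<open>u @ m\<close> the last arrow of \<open>u\<close> is
    followed by \<open>hd m\<close>, which is \<open>hd u\<close>; so the cycle closes up under
    \<open>T\<close>.\<close>
  have uT: "successively T u" "T (last u) (hd u)"
    using nonzero_successively_T[OF nz] m u0 unfolding hd_u by (simp_all add: successively_append_iff)
  note u = u0 uT
  have cyc: "cyclic u"
    using u nz by (auto simp: cyclic_def nonzero_def T_def successively_append_iff)
  obtain u2 where u2: "u = hd m # u2" using u0 hd_u by (cases u) auto
  \<comment> \<open>The walk \<open>m @ [z]\<close> starts at \<open>hd u\<close>, so it follows the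
    periodic word from its beginning; \<open>length r\<close> copies are certainly long
    enough.\<close>
  have mz_prefix: "prefix (m @ [z]) (concat (replicate p u))" if "length r \<le> p" for p
  proof -
    obtain q where q: "p = Suc q" using \<open>length r \<le> p\<close> r(2) by (cases p) auto
    have "prefix (m @ [z]) (hd (m @ [z]) # u2 @ concat (replicate q u))"
      by (rule T_walk_prefix_power[OF u nonzero_successively_T[OF mz], of "[]"])
         (use m u2 that in \<open>auto simp: r_eq q\<close>)
    moreover have "concat (replicate p u) = hd (m @ [z]) # u2 @ concat (replicate q u)"
      using m by (simp add: q) (metis append_Cons u2)
    ultimately show ?thesis by simp
  qed
  \<comment> \<open>The final arrow \<open>a\<close> of the first copy, followed by
    \<open>m @ [z]\<close> at the start of the remaining copies, spells \<open>r\<close>.\<close>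
  have "sublist r (concat (replicate (Suc (length r)) u))"
  proof -
    obtain t where "concat (replicate (length r) u) = (m @ [z]) @ t"
      using mz_prefix[of "length r"] by (auto simp: prefix_def)
    then have "concat (replicate (Suc (length r)) u) = x @ r @ t"
      by (simp add: u_def r_eq)
    then show ?thesis by (simp del: replicate_Suc)
  qed
  moreover have "r' = r" if r': "r' \<in> R" "sublist r' (concat (replicate p u))" for r' p
    using r'(2)
  proof (induction p)
    case 0
    then show ?case using length_relation[OF r'(1)] by auto
  next
    case (Suc p)
    have not_um: "\<not> sublist r' (u @ m)"
      using nz r'(1) by (auto simp: nonzero_def zero_word_def)
    \<comment> \<open>Split at the end of the first copy: \<open>r'\<close> lies before it, after
      it, or straddles it as \<open>s @ t\<close>.\<close>
    from Suc.prems consider "sublist r' u" | "sublist r' (concat (replicate p u))"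
      | s t where "r' = s @ t" "s \<noteq> []" "suffix s u" "prefix t (concat (replicate p u))"
      by (auto simp: sublist_append) (metis append_Nil prefix_imp_sublist)
    then show ?case
    proof cases
      case 1
      then show ?thesis using not_um by (simp add: sublist_append)
    next
      case 3
      from 3(2,3) obtain s' where s': "s = s' @ [a]"
        by (cases s rule: rev_cases) (auto simp: u_def)
      \<comment> \<open>There may be too few copies for \<open>mz_prefix\<close>, so
        \<open>length r\<close> more are appended before comparing \<open>t\<close> with
        \<open>m @ [z]\<close>.\<close>
      have "prefix (concat (replicate p u)) (concat (replicate (p + length r) u))"
        by (simp add: replicate_add)
      with 3(4) have "prefix t (concat (replicate (p + length r) u))"
        using prefix_order.trans by blast
      with mz_prefix[of "p + length r"] have "prefix t (m @ [z]) \<or> prefix (m @ [z]) t"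
        using prefix_same_cases by (metis le_add2)
      \<comment> \<open>Otherwise \<open>r' = s @ t\<close> would lie in the nonzero word
        \<open>u @ m\<close>. Hence \<open>t\<close> reaches past \<open>m @ [z]\<close>, and with
        the final \<open>a\<close> of \<open>s\<close> it contains all of \<open>r\<close>.\<close>
      moreover have "\<not> prefix t m"
        using not_um 3 by (auto simp: sublist_append)
      ultimately have "prefix (m @ [z]) t" by auto
      then obtain t' where "t = (m @ [z]) @ t'" by (auto simp: prefix_def)
      then have "r' = s' @ r @ t'" by (simp add: 3(1) s' r_eq)
      then show ?thesis using antichain[OF r(1) r'(1)] by auto
    qed (rule Suc.IH)
  qed
  ultimately have "{r' \<in> R. \<exists>p>0. sublist r' (concat (replicate p u))} = {r}"
    using r(1) by blast
  with cyc show ?thesis by blast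
qed

section \<open>From cycles to unique maximal words\<close>

text \<open>Prepending to \<open>M\<close> the arrow \<open>b\<close> that precedes
  \<open>hd M\<close> on the cycle gives a zero word that still lies on the periodic word. The
  relation in it can only be \<open>r\<close>, and it begins at \<open>b\<close> because
  \<open>M\<close> is nonzero.\<close>

lemma maximal_starts_with_tl:
  assumes u: "u \<noteq> []" "successively T u" "T (last u) (hd u)"
    and r: "{r' \<in> R. \<exists>p>0. sublist r' (concat (replicate p u))} = {r}"
    and M: "maximal M" "a \<in> set M" "a \<in> set u"
  shows "prefix (tl r) M"
proof -
  have MT: "successively T M" using M(1) by (auto simp: maximal_def nonzero_successively_T)
  have hd: "hd M \<in> set u" by (rule T_walk_in_power(1)[OF u MT M(2,3)])
  then obtain u1 u2 where u12: "u = u1 @ hd M # u2" by (meson split_list)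
  obtain b where b: "T b (hd M)"
  proof (cases u1 rule: rev_cases)
    case Nil
    with that u(3) u12 show ?thesis by (metis append_Nil list.sel(1))
  next
    case (snoc v c)
    with that u(2) u12 show ?thesis by (auto simp: successively_append_iff)
  qed
  then have "zero_word (b # M)" using M(1) by (auto simp: maximal_def T_def)
  then obtain r' where r': "r' \<in> R" "sublist r' (b # M)" by (auto simp: zero_word_def)
  have "successively T (b # M)" using b MT by (auto simp: successively_Cons)
  from T_walk_in_power(2)[OF u this _ M(3)] M(2)
  obtain p where "p > 0" "sublist (b # M) (concat (replicate p u))" by auto
  with r' r have "r' = r" using sublist_order.order.trans by blast
  moreover have "\<not> sublist r' M" using r'(1) M(1) by (auto simp: maximal_def nonzero_def zero_word_def)
  ultimately have "prefix r (b # M)" using r'(2) by (auto simp: sublist_Cons_right)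
  then show ?thesis by (cases r) auto
qed

text \<open>\<open>M'\<close> sticks out on the left of \<open>M\<close> by \<open>b\<close>. The
  relation in \<open>b # M\<close> begins at \<open>b\<close>, and ending at \<open>a\<close> or
  earlier would place it inside the nonzero word \<open>M'\<close>. So it runs strictly past
  \<open>a\<close>.\<close>

lemma relation_at_overhang:
  assumes "maximal M" "M = p @ a # q" "nonzero M'" "M' = x @ (b # p) @ a # q'"
  shows "\<exists>r\<in>R. 2 < length r \<and> a \<in> set r"
proof -
  have "C b (hd M)"
    using assms by (cases p) (auto simp: nonzero_def successively_append_iff)
  then have "zero_word (b # M)" using assms(1) by (auto simp: maximal_def)
  then obtain r where r: "r \<in> R" "sublist r (b # M)" by (auto simp: zero_word_def)
  have "\<not> sublist r M" using r(1) assms(1) by (auto simp: maximal_def nonzero_def zero_word_def)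
  with r(2) have "prefix r (b # M)" by (auto simp: sublist_Cons_right)
  moreover have "prefix (b # p @ [a]) (b # M)" by (simp add: assms(2) prefix_def)
  ultimately consider "prefix r (b # p @ [a])" | "strict_prefix (b # p @ [a]) r"
    using prefix_same_cases prefix_order.order_iff_strict by blast
  then show ?thesis
  proof cases
    case 1
    have "sublist (b # p @ [a]) M'"
      using sublist_appendI[of "b # p @ [a]" x q'] by (simp add: assms(4))
    with 1 have "sublist r M'"
      using prefix_imp_sublist sublist_order.order.trans by blast
    with r(1) assms(3) show ?thesis by (auto simp: nonzero_def zero_word_def)
  next
    case 2
    then have "length (b # p @ [a]) < length r" "a \<in> set r"
      by (auto simp: strict_prefix_def prefix_def intro: prefix_length_less[OF 2, simplified])
    with r(1) show ?thesis by (intro bexI[of _ r]) auto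
  qed
qed

lemma unique_maximal_if_cyclic_power:
  assumes cond: "\<And>r. r \<in> R \<Longrightarrow> 2 < length r \<Longrightarrow>
      \<exists>u. cyclic u \<and> {r' \<in> R. \<exists>p>0. sublist r' (concat (replicate p u))} = {r}"
    and M: "maximal M" "a \<in> set M" and M': "maximal M'" "a \<in> set M'"
  shows "M = M'"
proof -
  \<comment> \<open>It suffices to find a long relation through \<open>a\<close>, since then both
    maximal words start with \<open>tl r\<close>.\<close>
  have main: "M = M'" if r: "r \<in> R" "2 < length r" "a \<in> set r" for r
  proof -
    obtain u where u: "cyclic u" and ur: "{r' \<in> R. \<exists>p>0. sublist r' (concat (replicate p u))} = {r}"
      using cond[OF r(1,2)] by blast
    have u0: "u \<noteq> []" using u by (simp add: cyclic_def)
    \<comment> \<open>The only relation on the powers of \<open>u\<close> is \<open>r\<close>, which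
      is longer than two.\<close>
    have no2: "[b, c] \<notin> R" if "sublist [b, c] (concat (replicate p u))" for b c p
    proof
      assume "[b, c] \<in> R"
      moreover have "p > 0" using that by (cases p) auto
      ultimately have "[b, c] \<in> {r}" unfolding ur[symmetric] using that by blast
      with r(2) show False by auto
    qed
    \<comment> \<open>Two copies are taken so that the junction from \<open>last u\<close> to
      \<open>hd u\<close> is covered.\<close>
    have uT2: "successively T (concat (replicate 2 u))"
      using u by (intro successively_T successively_power) (auto simp: cyclic_def no2)
    then have uT: "successively T u" "T (last u) (hd u)"
      using u0 by (auto simp: numeral_2_eq_2 successively_append_iff)
    have "r \<in> {r}" by simp
    then obtain p where "sublist r (concat (replicate p u))" unfolding ur[symmetric] by blast
    then have a: "a \<in> set u" using r(3) set_mono_sublist by fastforce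
    have s: "tl r \<noteq> []" using r(2) by (cases r) auto
    have p1: "prefix (tl r) M" by (rule maximal_starts_with_tl[OF u0 uT ur M a])
    have p2: "prefix (tl r) M'" by (rule maximal_starts_with_tl[OF u0 uT ur M' a])
    have nz: "nonzero M" "nonzero M'" using M(1) M'(1) by (auto simp: maximal_def)
    have "hd M = hd M'" using p1 p2 s by (auto simp: prefix_def)
    then have "prefix M M' \<or> prefix M' M"
      using nz by (intro T_walks_comparable nonzero_successively_T) (auto simp: nonzero_def)
    then show ?thesis
      using maximal_sublist_eq[OF M(1) nz(2)] maximal_sublist_eq[OF M'(1) nz(1)]
        prefix_imp_sublist by metis
  qed
  have nz: "nonzero M" "nonzero M'" using M(1) M'(1) by (auto simp: maximal_def)
  obtain p q where pq: "M = p @ a # q" using M(2) by (meson split_list)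
  obtain p' q' where pq': "M' = p' @ a # q'" using M'(2) by (meson split_list)
  have MT: "successively T M" "successively T M'" using nz by (auto intro: nonzero_successively_T)
  have "suffix p p' \<or> suffix p' p"
    using MT by (intro T_walks_comparable_left[of _ a]) (auto simp: pq pq' successively_append_iff)
  \<comment> \<open>Either the parts before \<open>a\<close> coincide, and then one word is a prefix
    of the other, or one word overhangs on the left and \<open>relation_at_overhang\<close> supplies
    the relation for \<open>main\<close>.\<close>
  then consider "p = p'" | x b where "p' = x @ b # p" | x b where "p = x @ b # p'"
    unfolding suffix_def by (metis append_Nil append.assoc append_Cons rev_exhaust)
  then show ?thesis
  proof cases
    case 1
    have "prefix M M' \<or> prefix M' M"
      using T_walks_comparable[of "a # q" "a # q'"] MT
      by (auto simp: pq pq' 1 successively_append_iff)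
    then show ?thesis
      using maximal_sublist_eq[OF M(1) nz(2)] maximal_sublist_eq[OF M'(1) nz(1)]
        prefix_imp_sublist by metis
  next
    case 2
    show ?thesis
      using relation_at_overhang[OF M(1) pq, of M' x b q'] nz(2) main by (auto simp: pq' 2)
  next
    case 3
    show ?thesis
      using relation_at_overhang[OF M'(1) pq', of M x b q] nz(1) main by (auto simp: pq 3)
  qed
qed

theorem unique_maximal_iff_cyclic_power:
  "(\<forall>a\<in>A. \<exists>!w. maximal w \<and> a \<in> set w) \<longleftrightarrow>
   (\<forall>r\<in>R. 2 < length r \<longrightarrow>
      (\<exists>u. cyclic u \<and> {r' \<in> R. \<exists>p>0. sublist r' (concat (replicate p u))} = {r}))"
  (is "?L \<longleftrightarrow> ?P")
proof
  assume L: ?L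
  show ?P
  proof (intro ballI impI)
    fix r assume "r \<in> R" "2 < length r"
    then show "\<exists>u. cyclic u \<and> {r' \<in> R. \<exists>p>0. sublist r' (concat (replicate p u))} = {r}"
      by (rule cyclic_power_if_unique_maximal[rotated]) (use L in blast)
  qed
next
  assume P: ?P
  show ?L
  proof
    fix a assume "a \<in> A"
    obtain v where v: "maximal v" "sublist [a] v"
      using nonzero_extends_to_maximal[OF nonzero_arrow[OF \<open>a \<in> A\<close>]] .
    show "\<exists>!w. maximal w \<and> a \<in> set w"
    proof (rule ex1I[of _ v])
      show "maximal v \<and> a \<in> set v" using v set_mono_sublist[OF v(2)] by simp
      show "w = v" if "maximal w \<and> a \<in> set w" for w
        by (rule unique_maximal_if_cyclic_power[of w a v])
           (use that P v set_mono_sublist[OF v(2)] in auto)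
    qed
  qed
qed

end

section \<open>Paths of the quiver as words of arrows\<close>

definition composable :: "('v, 'e) pre_digraph \<Rightarrow> 'e \<Rightarrow> 'e \<Rightarrow> bool" where
  "composable Q a b \<longleftrightarrow> a \<in> arcs Q \<and> b \<in> arcs Q \<and> head Q a = tail Q b"

text \<open>Recovers a path from its arrows. It is meaningful only for nonempty \<open>es\<close>,
  since \<open>hd []\<close> is unspecified.\<close>

definition word_path :: "('v, 'e) pre_digraph \<Rightarrow> 'e list \<Rightarrow> ('v, 'e) qpath" where
  "word_path Q es = (tail Q (hd es), es)"

lemma path_target_Nil [simp]: "path_target Q (v, []) = v"
  by (simp add: path_target_def pre_digraph.awalk_verts.simps)

lemma path_target_Cons: "path_target Q (v, e # es) = path_target Q (head Q e, es)"
  by (cases es) (simp_all add: path_target_def pre_digraph.awalk_verts.simps)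

lemma path_target_nonempty: "snd p \<noteq> [] \<Longrightarrow> path_target Q p = head Q (last (snd p))"
proof (induction "snd p" arbitrary: p)
  case (Cons e es)
  then show ?case
    by (cases p; cases es) (auto simp: path_target_Cons)
qed simp

lemma qpaths_Nil_iff [simp]: "fin_digraph Q \<Longrightarrow> (v, []) \<in> qpaths Q \<longleftrightarrow> v \<in> verts Q"
  by (auto simp: qpaths_def pre_digraph.awalk_def pre_digraph.cas.simps)

lemma qpaths_Cons_iff:
  assumes "fin_digraph Q"
  shows "(v, e # es) \<in> qpaths Q \<longleftrightarrow> e \<in> arcs Q \<and> tail Q e = v \<and> (head Q e, es) \<in> qpaths Q"
proof -
  interpret fin_digraph Q by fact
  show ?thesis by (auto simp: qpaths_def awalk_Cons_iff)
qed

text \<open>Turns paths into words with local conditions. The condition on \<open>set es\<close>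
  matters for a single arrow, where \<open>successively\<close> is vacuous.\<close>

lemma qpaths_nonempty_iff:
  assumes "fin_digraph Q" "es \<noteq> []"
  shows "(v, es) \<in> qpaths Q \<longleftrightarrow>
    v = tail Q (hd es) \<and> set es \<subseteq> arcs Q \<and> successively (composable Q) es"
  using assms(2)
proof (induction es arbitrary: v)
  case (Cons e es)
  interpret fin_digraph Q by fact
  show ?case
    using Cons.IH
    by (cases "es = []") (auto simp: qpaths_Cons_iff[OF assms(1)] assms(1) successively_Cons composable_def)
qed simp

lemma qpaths_append_iff:
  assumes "fin_digraph Q"
  shows "(v, xs @ ys) \<in> qpaths Q \<longleftrightarrow> (v, xs) \<in> qpaths Q \<and> (path_target Q (v, xs), ys) \<in> qpaths Q"
proof (induction xs arbitrary: v)
  case Nil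
  have "(v, ys) \<in> qpaths Q \<Longrightarrow> v \<in> verts Q"
    using qpaths_ends(1)[OF assms, of "(v, ys)"] by (simp add: path_source_def)
  then show ?case using assms by auto
next
  case (Cons e xs)
  then show ?case
    by (auto simp: qpaths_Cons_iff[OF assms] path_target_Cons)
qed

lemma word_path_eq:
  assumes "fin_digraph Q" "p \<in> qpaths Q" "snd p \<noteq> []"
  shows "p = word_path Q (snd p)"
  using assms qpaths_nonempty_iff[OF assms(1,3), of "fst p"] by (cases p) (auto simp: word_path_def)

lemma subpath_imp_sublist: "subpath Q q p \<Longrightarrow> sublist (snd q) (snd p)"
  by (auto simp: subpath_def path_append_def)

text \<open>The first arrow of \<open>q\<close> fixes its start vertex, so the split of the arrow
  lists is a split of paths. For trivial \<open>q\<close> this fails: the empty list is a sublist of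
  every list, but the vertex of \<open>q\<close> may be off the path.\<close>

lemma path_decomposition:
  assumes Q: "fin_digraph Q" and p: "p \<in> qpaths Q" and q: "q \<in> qpaths Q" "snd q \<noteq> []"
    and "sublist (snd q) (snd p)"
  obtains x y where "x \<in> qpaths Q" "y \<in> qpaths Q" "path_target Q x = path_source q"
    "path_target Q q = path_source y" "p = path_append x (path_append q y)"
proof -
  obtain xs ys where eq: "snd p = xs @ snd q @ ys"
    using assms(5) by (auto simp: sublist_def)
  define v where "v = fst p"
  have "(v, xs @ snd q @ ys) \<in> qpaths Q"
    using p by (simp add: v_def flip: eq)
  then have *: "(v, xs) \<in> qpaths Q" "(path_target Q (v, xs), snd q) \<in> qpaths Q"
    "(path_target Q (path_target Q (v, xs), snd q), ys) \<in> qpaths Q"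
    by (simp_all add: qpaths_append_iff[OF Q])
  have "path_target Q (v, xs) = fst q"
    using *(2) q qpaths_nonempty_iff[OF Q q(2)] by (cases q) auto
  moreover from this have "path_target Q (path_target Q (v, xs), snd q) = path_target Q q"
    by simp
  moreover have "p = path_append (v, xs) (path_append q (path_target Q q, ys))"
    by (simp add: path_append_def v_def flip: eq)
  ultimately show ?thesis
    using * that[of "(v, xs)" "(path_target Q q, ys)"] by (simp add: path_source_def)
qed

lemma subpath_iff_sublist:
  assumes "fin_digraph Q" "p \<in> qpaths Q" "q \<in> qpaths Q" "snd q \<noteq> []"
  shows "subpath Q q p \<longleftrightarrow> sublist (snd q) (snd p)"
proof
  assume "sublist (snd q) (snd p)"
  from path_decomposition[OF assms this] show "subpath Q q p"
    using assms(3) unfolding subpath_def by blast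
qed (rule subpath_imp_sublist)

section \<open>Ideals spanned by paths\<close>

lemma keys_path_mult:
  assumes "r \<in> Poly_Mapping.keys (path_mult Q f g)"
  shows "\<exists>p\<in>Poly_Mapping.keys f. \<exists>q\<in>Poly_Mapping.keys g.
    path_target Q p = path_source q \<and> r = path_append p q"
proof -
  have "Poly_Mapping.keys (path_mult Q f g) \<subseteq> {path_append p q | p q. p \<in> Poly_Mapping.keys f \<and>
      q \<in> Poly_Mapping.keys g \<and> path_target Q p = path_source q}"
    unfolding path_mult_def by (intro keys_sum_subset) auto
  with assms show ?thesis by blast
qed

lemma path_algebra_simps [simp]:
  "f \<in> carrier (path_algebra Q) \<longleftrightarrow> Poly_Mapping.keys f \<subseteq> qpaths Q"
  "f \<otimes>\<^bsub>path_algebra Q\<^esub> g = path_mult Q f g"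
  "f \<oplus>\<^bsub>path_algebra Q\<^esub> g = f + g"
  "\<zero>\<^bsub>path_algebra Q\<^esub> = 0"
  by (simp_all add: path_algebra_def)

lemma path_algebra_a_inv:
  fixes f :: "('v, 'e) qpath \<Rightarrow>\<^sub>0 'k::field"
  assumes "fin_digraph Q" "f \<in> carrier (path_algebra Q)"
  shows "\<ominus>\<^bsub>path_algebra Q\<^esub> f = - f"
proof -
  interpret ring "path_algebra Q :: (('v, 'e) qpath \<Rightarrow>\<^sub>0 'k) ring"
    by (rule ring_path_algebra[OF assms(1)])
  show ?thesis
    by (rule minus_equality) (use assms in \<open>auto simp: in_keys_iff\<close>)
qed

text \<open>The keys of a product are concatenations of keys, so stability of \<open>P\<close> under
  concatenation on both sides suffices. It provides upper bounds for generated ideals through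
  \<open>genideal_minimal\<close>.\<close>

lemma ideal_supported_on_paths:
  fixes P :: "('v, 'e) qpath \<Rightarrow> bool"
  assumes Q: "fin_digraph Q"
    and left: "\<And>p x. P p \<Longrightarrow> P (path_append x p)" and right: "\<And>p x. P p \<Longrightarrow> P (path_append p x)"
  shows "ideal {f. \<forall>p\<in>Poly_Mapping.keys f. p \<in> qpaths Q \<and> P p}
    (path_algebra Q :: (('v, 'e) qpath \<Rightarrow>\<^sub>0 'k::field) ring)" (is "ideal ?J ?A")
proof (rule idealI)
  interpret ring ?A by (rule ring_path_algebra[OF Q])
  show "ring ?A" by (rule ring_axioms)
  show "subgroup ?J (add_monoid ?A)"
  proof
    fix f g assume "f \<in> ?J" "g \<in> ?J"
    then show "f \<otimes>\<^bsub>add_monoid ?A\<^esub> g \<in> ?J"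
      using Poly_Mapping.keys_add[of f g] by auto
  next
    fix f assume f: "f \<in> ?J"
    then have "inv\<^bsub>add_monoid ?A\<^esub> f = - f"
      using path_algebra_a_inv[OF Q, of f] by (auto simp: a_inv_def)
    with f show "inv\<^bsub>add_monoid ?A\<^esub> f \<in> ?J" by (auto simp: in_keys_iff)
  qed (auto simp: path_algebra_def)
next
  fix f x assume f: "f \<in> ?J" and x: "x \<in> carrier ?A"
  then show "x \<otimes>\<^bsub>?A\<^esub> f \<in> ?J"
    using left path_append_in_qpaths[OF Q] by (auto dest!: keys_path_mult)
  show "f \<otimes>\<^bsub>?A\<^esub> x \<in> ?J"
    using f x right path_append_in_qpaths[OF Q] by (auto dest!: keys_path_mult)
qed

text \<open>The right-hand side is an ideal containing the generators. Conversely, a path containing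
  some \<open>s\<close> is a product \<open>x s y\<close>, and an element of the right-hand side is
  a finite sum of multiples of such paths.\<close>

lemma path_ideal_eq:
  fixes S :: "('v, 'e) qpath set"
  assumes Q: "fin_digraph Q" and S: "S \<subseteq> qpaths Q" "\<And>s. s \<in> S \<Longrightarrow> snd s \<noteq> []"
  shows "path_ideal Q S = {f :: ('v, 'e) qpath \<Rightarrow>\<^sub>0 'k::field.
    \<forall>p\<in>Poly_Mapping.keys f. p \<in> qpaths Q \<and> (\<exists>s\<in>S. sublist (snd s) (snd p))}" (is "_ = ?J")
proof
  let ?A = "path_algebra Q :: (('v, 'e) qpath \<Rightarrow>\<^sub>0 'k) ring"
  interpret ring ?A by (rule ring_path_algebra[OF Q])
  have "ideal ?J ?A"
    by (rule ideal_supported_on_paths[OF Q]) (auto simp: path_append_def sublist_append)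
  moreover have "path_elem ` S \<subseteq> ?J"
    using S by (auto simp: path_elem_def)
  ultimately show "path_ideal Q S \<subseteq> ?J"
    unfolding path_ideal_def by (rule genideal_minimal)
next
  let ?A = "path_algebra Q :: (('v, 'e) qpath \<Rightarrow>\<^sub>0 'k) ring"
  interpret ring ?A by (rule ring_path_algebra[OF Q])
  have gen: "path_elem ` S \<subseteq> carrier ?A" using S by (auto simp: path_elem_def)
  interpret I: ideal "path_ideal Q S" ?A
    unfolding path_ideal_def by (rule genideal_ideal[OF gen])
  have single: "Poly_Mapping.single p c \<in> path_ideal Q S"
    if p: "p \<in> qpaths Q" "s \<in> S" "sublist (snd s) (snd p)" for p s and c :: 'k
  proof -
    have s: "s \<in> qpaths Q" "snd s \<noteq> []" using S p(2) by auto
    obtain x y where xy: "x \<in> qpaths Q" "y \<in> qpaths Q" "path_target Q x = path_source s"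
      "path_target Q s = path_source y" "p = path_append x (path_append s y)"
      using path_decomposition[OF Q p(1) s p(3)] .
    have "path_elem s \<in> (path_ideal Q S :: (('v, 'e) qpath \<Rightarrow>\<^sub>0 'k) set)"
      unfolding path_ideal_def by (rule subsetD[OF genideal_self[OF gen]]) (rule imageI[OF p(2)])
    \<comment> \<open>The left factor carries the coefficient \<open>c\<close>.\<close>
    then have "Poly_Mapping.single x c \<otimes>\<^bsub>?A\<^esub> (path_elem s \<otimes>\<^bsub>?A\<^esub> Poly_Mapping.single y 1)
        \<in> path_ideal Q S"
      by (intro I.I_l_closed I.I_r_closed) (simp_all add: xy(1,2))
    also have "Poly_Mapping.single x c \<otimes>\<^bsub>?A\<^esub> (path_elem s \<otimes>\<^bsub>?A\<^esub> Poly_Mapping.single y 1)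
        = Poly_Mapping.single p c"
      using xy by (auto simp: path_elem_def path_mult_single path_source_def path_append_def)
    finally show ?thesis .
  qed
  show "?J \<subseteq> path_ideal Q S"
  proof
    fix f assume f: "f \<in> ?J"
    have "(\<Sum>p\<in>K. Poly_Mapping.single p (Poly_Mapping.lookup f p)) \<in> path_ideal Q S"
      if "K \<subseteq> Poly_Mapping.keys f" for K
      using finite_subset[OF that finite_keys] that
    proof (induction K)
      case empty
      then show ?case using I.zero_closed by simp
    next
      case (insert p K)
      then obtain s where "p \<in> qpaths Q" "s \<in> S" "sublist (snd s) (snd p)" using f by blast
      from I.a_closed[OF single[OF this]] insert show ?case by auto
    qed
    moreover have "f = (\<Sum>p\<in>Poly_Mapping.keys f. Poly_Mapping.single p (Poly_Mapping.lookup f p))"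
      by (rule poly_mapping_eqI) (auto simp: lookup_sum lookup_single when_def in_keys_iff)
    ultimately show "f \<in> path_ideal Q S" by (metis order_refl)
  qed
qed

lemma arrow_elem_eq: "arrow_elem Q a = Poly_Mapping.single (tail Q a, [a]) 1"
  by (simp add: arrow_elem_def path_elem_def arrow_path_def)

lemma arrow_elem_closed:
  "fin_digraph Q \<Longrightarrow> a \<in> arcs Q \<Longrightarrow> arrow_elem Q a \<in> carrier (path_algebra Q)"
  by (simp add: arrow_elem_eq qpaths_nonempty_iff)

lemma arrow_ideal_keys_length:
  fixes f :: "('v, 'e) qpath \<Rightarrow>\<^sub>0 'k::field"
  assumes Q: "fin_digraph Q" and f: "f \<in> arrow_ideal Q" and p: "p \<in> Poly_Mapping.keys f"
  shows "1 \<le> path_length p"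
proof -
  interpret ring "path_algebra Q :: (('v, 'e) qpath \<Rightarrow>\<^sub>0 'k) ring"
    by (rule ring_path_algebra[OF Q])
  let ?J = "{f :: ('v, 'e) qpath \<Rightarrow>\<^sub>0 'k. \<forall>p\<in>Poly_Mapping.keys f. p \<in> qpaths Q \<and> 1 \<le> path_length p}"
  have "ideal ?J (path_algebra Q :: (('v, 'e) qpath \<Rightarrow>\<^sub>0 'k) ring)"
    by (rule ideal_supported_on_paths[OF Q]) (auto simp: path_append_def path_length_def)
  moreover have "arrow_elem Q ` arcs Q \<subseteq> ?J"
    using Q by (auto simp: arrow_elem_eq qpaths_nonempty_iff path_length_def)
  ultimately have "arrow_ideal Q \<subseteq> ?J"
    unfolding arrow_ideal_def by (rule genideal_minimal)
  with f p show ?thesis by blast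
qed

text \<open>Lengths add under concatenation. The inner induction follows the generation of the
  product ideal by products and sums.\<close>

lemma arrow_ideal_power_keys_length:
  assumes Q: "fin_digraph Q" and "f \<in> arrow_ideal_power Q n" "p \<in> Poly_Mapping.keys f"
  shows "n \<le> path_length p"
  using assms(2,3)
proof (induction n arbitrary: f p)
  case (Suc n)
  from Suc.prems have "f \<in> arrow_ideal_power Q n \<cdot>\<^bsub>path_algebra Q\<^esub> arrow_ideal Q" by simp
  then show ?case
    using Suc.prems(2)
  proof (induction arbitrary: p)
    case (prod i j)
    then obtain q r where "q \<in> Poly_Mapping.keys i" "r \<in> Poly_Mapping.keys j" "p = path_append q r"
      by (auto dest: keys_path_mult)
    moreover from this have "n \<le> path_length q" "1 \<le> path_length r"
      using Suc.IH[OF prod(1)] arrow_ideal_keys_length[OF Q prod(2)] by auto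
    ultimately show ?case
      by (simp add: path_append_def path_length_def)
  next
    case (sum f g)
    from sum(5) have "p \<in> Poly_Mapping.keys f \<union> Poly_Mapping.keys g"
      using Poly_Mapping.keys_add[of f g] by auto
    with sum(3,4) show ?case by blast
  qed
qed simp

lemma path_in_arrow_ideal_power:
  assumes Q: "fin_digraph Q" and "(v, es) \<in> qpaths Q"
  shows "path_elem (v, es) \<in> (arrow_ideal_power Q (length es) :: (('v, 'e) qpath \<Rightarrow>\<^sub>0 'k::field) set)"
  using assms(2)
proof (induction es rule: rev_induct)
  case Nil
  then show ?case by (simp add: path_elem_def)
next
  case (snoc e es)
  let ?A = "path_algebra Q :: (('v, 'e) qpath \<Rightarrow>\<^sub>0 'k) ring"
  interpret ring ?A by (rule ring_path_algebra[OF Q])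
  have *: "(v, es) \<in> qpaths Q" "(path_target Q (v, es), [e]) \<in> qpaths Q"
    using snoc.prems by (simp_all add: qpaths_append_iff[OF Q])
  then have e: "e \<in> arcs Q" "path_target Q (v, es) = tail Q e"
    by (simp_all add: qpaths_nonempty_iff[OF Q])
  have "arrow_elem Q e \<in> (arrow_ideal Q :: (('v, 'e) qpath \<Rightarrow>\<^sub>0 'k) set)"
    unfolding arrow_ideal_def
    by (rule subsetD[OF genideal_self]) (use arrow_elem_closed[OF Q] e in blast)+
  then have "path_elem (v, es) \<otimes>\<^bsub>?A\<^esub> arrow_elem Q e \<in> arrow_ideal_power Q (Suc (length es))"
    unfolding arrow_ideal_power.simps by (intro ideal_prod.prod snoc.IH *)
  then show ?case
    using e by (simp add: arrow_elem_eq path_elem_def path_mult_single path_source_def path_append_def)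
qed

lemma sublist_singleton_iff: "sublist [a] w \<longleftrightarrow> a \<in> set w"
  by (auto simp: sublist_def in_set_conv_decomp)

lemma sublist_length_ge_imp_eq: "sublist v w \<Longrightarrow> length w \<le> length v \<Longrightarrow> v = w"
  by (auto simp: sublist_def)

section \<open>Translation of the algebra into words\<close>

locale monomial_quiver_algebra =
  fixes Q :: "('v, 'e) pre_digraph"
    and I :: "(('v, 'e) qpath \<Rightarrow>\<^sub>0 'k::field) set"
    and R :: "('v, 'e) qpath set"
  assumes finite_quiver: "fin_digraph Q"
    and admissible: "admissible Q I"
    and special_multiserial: "special_multiserial Q I"
    and minimal: "minimal_zero_relations Q I R"
begin

lemma relations: "R \<subseteq> qpaths Q" "path_ideal Q R = I"
  using minimal by (auto simp: minimal_zero_relations_def)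

text \<open>Admissibility puts \<open>I\<close> inside the square of the arrow ideal, whose elements
  involve only paths of length at least two.\<close>

lemma relation_length:
  assumes "r \<in> R"
  shows "2 \<le> length (snd r)"
proof -
  interpret ring "path_algebra Q :: (('v, 'e) qpath \<Rightarrow>\<^sub>0 'k) ring"
    by (rule ring_path_algebra[OF finite_quiver])
  have gen: "path_elem ` R \<subseteq> carrier (path_algebra Q :: (('v, 'e) qpath \<Rightarrow>\<^sub>0 'k) ring)"
    using relations(1) by (auto simp: path_elem_def)
  have "path_elem r \<in> I"
    unfolding relations(2)[symmetric] path_ideal_def
    by (rule subsetD[OF genideal_self[OF gen]]) (rule imageI[OF assms])
  then have "path_elem r \<in> (arrow_ideal_power Q 2 :: (('v, 'e) qpath \<Rightarrow>\<^sub>0 'k) set)"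
    using admissible unfolding admissible_def by blast
  from arrow_ideal_power_keys_length[OF finite_quiver this, of r] show ?thesis
    by (simp add: path_elem_def path_length_def)
qed

lemma relation_nonempty: "r \<in> R \<Longrightarrow> snd r \<noteq> []"
  using relation_length by fastforce

lemma relation_eq_word_path: "r \<in> R \<Longrightarrow> r = word_path Q (snd r)"
  by (rule word_path_eq[OF finite_quiver _ relation_nonempty]) (use relations(1) in auto)

lemma relation_eq_iff: "r \<in> R \<Longrightarrow> r' \<in> R \<Longrightarrow> snd r = snd r' \<longleftrightarrow> r = r'"
  using relation_eq_word_path[of r] relation_eq_word_path[of r'] by metis

lemma I_eq: "I = {f. \<forall>p\<in>Poly_Mapping.keys f. p \<in> qpaths Q \<and> (\<exists>r\<in>R. sublist (snd r) (snd p))}"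
  by (subst relations(2)[symmetric]) (rule path_ideal_eq[OF finite_quiver relations(1) relation_nonempty])

lemma path_elem_in_I_iff:
  "p \<in> qpaths Q \<Longrightarrow> path_elem p \<in> I \<longleftrightarrow> (\<exists>r\<in>R. sublist (snd r) (snd p))"
  by (subst I_eq) (simp add: path_elem_def)

lemma zero_in_I: "0 \<in> I"
  by (subst I_eq) simp

text \<open>If \<open>r\<close> were a proper part of \<open>r'\<close>, every path containing
  \<open>r'\<close> would contain \<open>r\<close>, so dropping \<open>r'\<close> would leave the
  ideal unchanged, against minimality.\<close>

lemma relation_antichain:
  assumes r: "r \<in> R" "r' \<in> R" "sublist (snd r) (snd r')"
  shows "r = r'"
proof (rule ccontr)
  assume ne: "r \<noteq> r'"
  have "(\<exists>s\<in>R - {r'}. sublist (snd s) (snd p)) \<longleftrightarrow> (\<exists>s\<in>R. sublist (snd s) (snd p))" for p :: "('v, 'e) qpath"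
    using r ne sublist_order.order.trans by (metis DiffD1 DiffI singletonD)
  moreover have "path_ideal Q (R - {r'}) = {f :: ('v, 'e) qpath \<Rightarrow>\<^sub>0 'k. \<forall>p\<in>Poly_Mapping.keys f.
      p \<in> qpaths Q \<and> (\<exists>s\<in>R - {r'}. sublist (snd s) (snd p))}"
    by (rule path_ideal_eq[OF finite_quiver]) (use relations(1) relation_nonempty in auto)
  ultimately have "path_ideal Q (R - {r'}) = I"
    by (subst I_eq) simp
  moreover have "R - {r'} \<subset> R" using r by blast
  ultimately show False
    using minimal by (auto simp: minimal_zero_relations_def)
qed

lemma word_path_in_qpaths:
  "w \<noteq> [] \<Longrightarrow> word_path Q w \<in> qpaths Q \<longleftrightarrow> set w \<subseteq> arcs Q \<and> successively (composable Q) w"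
  by (simp add: word_path_def qpaths_nonempty_iff[OF finite_quiver])

text \<open>A product of non-composable factors is \<open>0\<close> and lies in \<open>I\<close>,
  which is why the right-hand side is an implication.\<close>

lemma arrow_mult_path:
  assumes "a \<in> arcs Q" "p \<in> qpaths Q" "snd p \<noteq> []"
  shows "arrow_elem Q a \<otimes>\<^bsub>path_algebra Q\<^esub> path_elem p \<in> I \<longleftrightarrow>
    (composable Q a (hd (snd p)) \<longrightarrow> (\<exists>r\<in>R. sublist (snd r) (a # snd p)))"
proof -
  have p: "fst p = tail Q (hd (snd p))" "set (snd p) \<subseteq> arcs Q" "successively (composable Q) (snd p)"
    using assms(2,3) qpaths_nonempty_iff[OF finite_quiver assms(3), of "fst p"] by auto
  have comp: "composable Q a (hd (snd p)) \<longleftrightarrow> path_target Q (tail Q a, [a]) = path_source p"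
    using assms p hd_in_set[OF assms(3)] by (auto simp: composable_def path_target_nonempty path_source_def)
  show ?thesis
  proof (cases "composable Q a (hd (snd p))")
    case True
    have "(tail Q a, a # snd p) \<in> qpaths Q"
      using True assms p by (simp add: qpaths_nonempty_iff[OF finite_quiver] successively_Cons)
    from path_elem_in_I_iff[OF this] True comp show ?thesis
      by (simp add: arrow_elem_eq path_elem_def path_mult_single path_append_def)
  next
    case False
    with comp zero_in_I show ?thesis
      by (simp add: arrow_elem_eq path_elem_def path_mult_single)
  qed
qed

lemma path_mult_arrow:
  assumes "a \<in> arcs Q" "p \<in> qpaths Q" "snd p \<noteq> []"
  shows "path_elem p \<otimes>\<^bsub>path_algebra Q\<^esub> arrow_elem Q a \<in> I \<longleftrightarrow>
    (composable Q (last (snd p)) a \<longrightarrow> (\<exists>r\<in>R. sublist (snd r) (snd p @ [a])))"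
proof -
  have p: "fst p = tail Q (hd (snd p))" "set (snd p) \<subseteq> arcs Q" "successively (composable Q) (snd p)"
    using assms(2,3) qpaths_nonempty_iff[OF finite_quiver assms(3), of "fst p"] by auto
  have comp: "composable Q (last (snd p)) a \<longleftrightarrow> path_target Q p = path_source (tail Q a, [a])"
    using assms p last_in_set[OF assms(3)] by (auto simp: composable_def path_target_nonempty path_source_def)
  show ?thesis
  proof (cases "composable Q (last (snd p)) a")
    case True
    have "(fst p, snd p @ [a]) \<in> qpaths Q"
      using True assms p by (simp add: qpaths_nonempty_iff[OF finite_quiver] successively_append_iff)
    from path_elem_in_I_iff[OF this] True comp show ?thesis
      by (simp add: arrow_elem_eq path_elem_def path_mult_single path_append_def)
  next
    case False
    with comp zero_in_I show ?thesis
      by (simp add: arrow_elem_eq path_elem_def path_mult_single)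
  qed
qed

text \<open>Relations have length at least two, so one inside \<open>[a, b]\<close> is all of
  it.\<close>

lemma arrow_mult_arrow:
  assumes "composable Q a b"
  shows "arrow_elem Q a \<otimes>\<^bsub>path_algebra Q\<^esub> arrow_elem Q b \<in> I \<longleftrightarrow> [a, b] \<in> snd ` R"
proof -
  have ab: "a \<in> arcs Q" "b \<in> arcs Q" using assms by (auto simp: composable_def)
  have b: "(tail Q b, [b]) \<in> qpaths Q"
    using ab by (simp add: qpaths_nonempty_iff[OF finite_quiver])
  have "sublist (snd r) [a, b] \<longleftrightarrow> [a, b] = snd r" if "r \<in> R" for r
    using sublist_length_ge_imp_eq[of "snd r" "[a, b]"] relation_length[OF that] by auto
  then have "(\<exists>r\<in>R. sublist (snd r) [a, b]) \<longleftrightarrow> [a, b] \<in> snd ` R"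
    unfolding image_iff by (rule bex_cong[OF refl])
  with arrow_mult_path[OF ab(1) b] assms show ?thesis
    by (simp add: arrow_elem_def arrow_path_def)
qed

text \<open>The first \<open>n\<close> arrows of \<open>w\<close> form a path in the
  \<open>n\<close>-th power of the arrow ideal, which admissibility puts inside \<open>I\<close> for
  a suitable \<open>n\<close>.\<close>

lemma long_word_has_relation:
  "\<exists>n. \<forall>w. set w \<subseteq> arcs Q \<and> successively (composable Q) w \<and> n \<le> length w \<longrightarrow>
    (\<exists>r\<in>snd ` R. sublist r w)"
proof -
  obtain n where n: "n \<ge> 2" "arrow_ideal_power Q n \<subseteq> I"
    using admissible by (auto simp: admissible_def)
  have "\<exists>r\<in>snd ` R. sublist r w"
    if w: "set w \<subseteq> arcs Q" "successively (composable Q) w" "n \<le> length w" for w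
  proof -
    have "take n w \<noteq> []" using n(1) w(3) by auto
    moreover have "successively (composable Q) (take n w @ drop n w)" using w(2) by simp
    then have "successively (composable Q) (take n w)"
      unfolding successively_append_iff by blast
    moreover have "set (take n w) \<subseteq> arcs Q" using w(1) set_take_subset[of n w] by blast
    ultimately have v: "word_path Q (take n w) \<in> qpaths Q"
      by (simp add: word_path_in_qpaths)
    then have "path_elem (word_path Q (take n w)) \<in> (arrow_ideal_power Q n :: (('v, 'e) qpath \<Rightarrow>\<^sub>0 'k) set)"
      using path_in_arrow_ideal_power[OF finite_quiver, of _ "take n w"] w(3)
      by (simp add: word_path_def min_absorb2)
    with n(2) path_elem_in_I_iff[OF v] obtain r where "r \<in> R" "sublist (snd r) (take n w)"
      by (auto simp: word_path_def)
    moreover have "sublist (take n w) w" by (simp add: sublist_take)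
    ultimately show ?thesis using sublist_order.order.trans by blast
  qed
  then show ?thesis by blast
qed

sublocale words: monomial_words "arcs Q" "composable Q" "snd ` R"
proof
  fix a b c
  show "a \<in> arcs Q \<and> b \<in> arcs Q" if "composable Q a b"
    using that by (simp add: composable_def)
  show "b = c" if h: "composable Q a b" "composable Q a c" "[a, b] \<notin> snd ` R" "[a, c] \<notin> snd ` R"
  proof -
    have "\<exists>\<^sub>\<le>\<^sub>1b. b \<in> arcs Q \<and> arrow_elem Q a \<otimes>\<^bsub>path_algebra Q\<^esub> arrow_elem Q b \<notin> I"
      using special_multiserial h(1) unfolding special_multiserial_def composable_def by blast
    from Uniq_D[OF this, of b c] h show ?thesis
      using arrow_mult_arrow[OF h(1)] arrow_mult_arrow[OF h(2)] unfolding composable_def by blast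
  qed
  show "b = c" if h: "composable Q b a" "composable Q c a" "[b, a] \<notin> snd ` R" "[c, a] \<notin> snd ` R"
  proof -
    have "\<exists>\<^sub>\<le>\<^sub>1c. c \<in> arcs Q \<and> arrow_elem Q c \<otimes>\<^bsub>path_algebra Q\<^esub> arrow_elem Q a \<notin> I"
      using special_multiserial h(1) unfolding special_multiserial_def composable_def by blast
    from Uniq_D[OF this, of b c] h show ?thesis
      using arrow_mult_arrow[OF h(1)] arrow_mult_arrow[OF h(2)] unfolding composable_def by blast
  qed
next
  fix r r' assume "r \<in> snd ` R" "r' \<in> snd ` R" "sublist r r'"
  then show "r = r'" using relation_antichain by blast
next
  fix r assume "r \<in> snd ` R"
  then obtain s where s: "s \<in> R" "r = snd s" by blast
  then show "2 \<le> length r" using relation_length by simp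
  have "word_path Q r \<in> qpaths Q" using s relation_eq_word_path relations(1) by auto
  then show "successively (composable Q) r"
    using word_path_in_qpaths[of r] s relation_nonempty by auto
qed (rule long_word_has_relation)

text \<open>Nonempty paths are enough here, because \<open>UMP\<close> asks only about paths through
  an arrow.\<close>

lemma maximal_iff:
  assumes "p \<in> qpaths Q" "snd p \<noteq> []"
  shows "path_elem p \<notin> I \<and> (\<forall>a\<in>arcs Q. arrow_elem Q a \<otimes>\<^bsub>path_algebra Q\<^esub> path_elem p \<in> I \<and>
      path_elem p \<otimes>\<^bsub>path_algebra Q\<^esub> arrow_elem Q a \<in> I) \<longleftrightarrow> words.maximal (snd p)"
proof -
  have "set (snd p) \<subseteq> arcs Q" "successively (composable Q) (snd p)"
    using assms qpaths_nonempty_iff[OF finite_quiver assms(2), of "fst p"] by auto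
  then have "path_elem p \<notin> I \<longleftrightarrow> words.nonzero (snd p)"
    using path_elem_in_I_iff[OF assms(1)] assms(2)
    by (simp add: words.nonzero_def words.zero_word_def)
  moreover have "(\<forall>a\<in>arcs Q. arrow_elem Q a \<otimes>\<^bsub>path_algebra Q\<^esub> path_elem p \<in> I) \<longleftrightarrow>
      (\<forall>a. composable Q a (hd (snd p)) \<longrightarrow> words.zero_word (a # snd p))"
    using arrow_mult_path[OF _ assms] words.composable_arrows by (auto simp: words.zero_word_def)
  moreover have "(\<forall>a\<in>arcs Q. path_elem p \<otimes>\<^bsub>path_algebra Q\<^esub> arrow_elem Q a \<in> I) \<longleftrightarrow>
      (\<forall>a. composable Q (last (snd p)) a \<longrightarrow> words.zero_word (snd p @ [a]))"
    using path_mult_arrow[OF _ assms] words.composable_arrows by (auto simp: words.zero_word_def)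
  ultimately show ?thesis
    unfolding words.maximal_def by blast
qed

text \<open>\<open>I\<close> is spanned by the paths it contains, so a path outside \<open>I\<close>
  cannot occur in any element of \<open>I\<close>, in particular not in a difference of two
  paths.\<close>

lemma path_coset_eq:
  assumes p: "path_elem p \<notin> I" "p \<in> qpaths Q"
    and eq: "I +>\<^bsub>path_algebra Q\<^esub> path_elem p = I +>\<^bsub>path_algebra Q\<^esub> path_elem q"
  shows "p = q"
proof (rule ccontr)
  assume ne: "p \<noteq> q"
  have "path_elem p \<in> I +>\<^bsub>path_algebra Q\<^esub> path_elem p"
    using zero_in_I by (force simp: a_r_coset_def')
  then obtain h where h: "h \<in> I" "path_elem p = h + path_elem q"
    unfolding eq by (auto simp: a_r_coset_def')
  have "Poly_Mapping.lookup (path_elem p :: _ \<Rightarrow>\<^sub>0 'k) p = Poly_Mapping.lookup h p + Poly_Mapping.lookup (path_elem q) p"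
    by (simp add: h(2) lookup_add)
  then have "p \<in> Poly_Mapping.keys h"
    using ne by (simp add: path_elem_def lookup_single when_def in_keys_iff)
  with h(1) have "\<exists>r\<in>R. sublist (snd r) (snd p)"
    by (subst (asm) I_eq) blast
  with p path_elem_in_I_iff[OF p(2)] show False by blast
qed

text \<open>Taking cosets is injective on maximal words, so uniqueness of the coset and uniqueness
  of the word amount to the same.\<close>

lemma UMP_iff: "UMP Q I \<longleftrightarrow> (\<forall>a\<in>arcs Q. \<exists>!w. words.maximal w \<and> a \<in> set w)"
proof -
  define coset where "coset w = I +>\<^bsub>path_algebra Q\<^esub> (path_elem (word_path Q w) :: _ \<Rightarrow>\<^sub>0 'k)" for w
  have word: "word_path Q w \<in> qpaths Q" "w \<noteq> []" "path_elem (word_path Q w) \<notin> I"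
    "coset w \<in> maximal_paths Q I" if "words.maximal w" for w
  proof -
    show w: "w \<noteq> []" using that by (simp add: words.maximal_def words.nonzero_def)
    then show q: "word_path Q w \<in> qpaths Q"
      using that word_path_in_qpaths[OF w] by (simp add: words.maximal_def words.nonzero_def)
    have "snd (word_path Q w) = w" by (simp add: word_path_def)
    with maximal_iff[OF q] w that
    have *: "path_elem (word_path Q w) \<notin> I"
      "\<forall>a\<in>arcs Q. arrow_elem Q a \<otimes>\<^bsub>path_algebra Q\<^esub> path_elem (word_path Q w) \<in> I \<and>
        path_elem (word_path Q w) \<otimes>\<^bsub>path_algebra Q\<^esub> arrow_elem Q a \<in> I"
      by simp_all
    then show "path_elem (word_path Q w) \<notin> I" by blast
    show "coset w \<in> maximal_paths Q I"
      using q * unfolding maximal_paths_def coset_def by blast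
  qed
  have inj: "v = w" if "words.maximal v" "words.maximal w" "coset v = coset w" for v w
  proof -
    have "word_path Q v = word_path Q w"
      using path_coset_eq[OF word(3,1)[OF that(1)]] that(3) unfolding coset_def by blast
    then show ?thesis by (simp add: word_path_def)
  qed
  have set_eq: "M \<in> maximal_paths Q I \<and>
        (\<exists>m\<in>qpaths Q. M = I +>\<^bsub>path_algebra Q\<^esub> path_elem m \<and> subpath Q (arrow_path Q a) m) \<longleftrightarrow>
      (\<exists>w. words.maximal w \<and> a \<in> set w \<and> M = coset w)" (is "?L \<longleftrightarrow> ?W") if a: "a \<in> arcs Q" for a M
  proof -
    have sub: "subpath Q (arrow_path Q a) m \<longleftrightarrow> a \<in> set (snd m)" if "m \<in> qpaths Q" for m
      using subpath_iff_sublist[OF finite_quiver that, of "arrow_path Q a"] a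
      by (simp add: arrow_path_def qpaths_nonempty_iff[OF finite_quiver] sublist_singleton_iff)
    show ?thesis
    proof
      assume ?L
      then obtain m m' where m: "m \<in> qpaths Q" "path_elem m \<notin> I"
          "\<forall>b\<in>arcs Q. arrow_elem Q b \<otimes>\<^bsub>path_algebra Q\<^esub> path_elem m \<in> I \<and>
            path_elem m \<otimes>\<^bsub>path_algebra Q\<^esub> arrow_elem Q b \<in> I"
          "M = I +>\<^bsub>path_algebra Q\<^esub> path_elem m"
        and m': "m' \<in> qpaths Q" "M = I +>\<^bsub>path_algebra Q\<^esub> path_elem m'" "subpath Q (arrow_path Q a) m'"
        unfolding maximal_paths_def by blast
      \<comment> \<open>The representative through \<open>a\<close> could a priori differ from the
        one known to be maximal; equality of the cosets identifies them.\<close>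
      have "m = m'" using path_coset_eq[OF m(2,1)] m(4) m'(2) by blast
      then have am: "a \<in> set (snd m)" using sub m'(1,3) by blast
      then have ne: "snd m \<noteq> []" by auto
      have "words.maximal (snd m)" using maximal_iff[OF m(1) ne] m(2,3) by blast
      moreover have "M = coset (snd m)"
        using m(4) word_path_eq[OF finite_quiver m(1) ne] by (simp add: coset_def)
      ultimately show ?W using am by blast
    next
      assume ?W
      then obtain w where w: "words.maximal w" "a \<in> set w" "M = coset w" by blast
      have "subpath Q (arrow_path Q a) (word_path Q w)"
        using sub[OF word(1)[OF w(1)]] w(2) by (simp add: word_path_def)
      with word[OF w(1)] w(3) show ?L unfolding coset_def by blast
    qed
  qed
  have "(\<exists>!M. \<exists>w. words.maximal w \<and> a \<in> set w \<and> M = coset w) \<longleftrightarrow>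
      (\<exists>!w. words.maximal w \<and> a \<in> set w)" (is "?L \<longleftrightarrow> ?W") for a
  proof
    assume ?L
    then obtain M where ex: "\<exists>w. words.maximal w \<and> a \<in> set w \<and> M = coset w"
      and uniq: "\<And>N. \<exists>w. words.maximal w \<and> a \<in> set w \<and> N = coset w \<Longrightarrow> N = M" by (rule ex1E) blast
    from ex obtain w where w: "words.maximal w" "a \<in> set w" "M = coset w" by blast
    show ?W
    proof (rule ex1I)
      show "words.maximal w \<and> a \<in> set w" using w by simp
      show "v = w" if v: "words.maximal v \<and> a \<in> set v" for v
        using inj[of v w] v w uniq[of "coset v"] by blast
    qed
  next
    assume ?W
    then obtain w where w: "words.maximal w" "a \<in> set w"
      and uniq: "\<And>v. words.maximal v \<and> a \<in> set v \<Longrightarrow> v = w" by (rule ex1E) blast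
    show ?L
    proof (rule ex1I)
      show "\<exists>v. words.maximal v \<and> a \<in> set v \<and> coset w = coset v" using w by blast
      show "N = coset w" if "\<exists>v. words.maximal v \<and> a \<in> set v \<and> N = coset v" for N
        using that uniq by blast
    qed
  qed
  then show ?thesis
    unfolding UMP_def by (intro ball_cong refl) (simp only: set_eq)
qed

lemma cyclic_word_path_iff:
  "u \<in> qpaths Q \<and> path_target Q u = path_source u \<and> snd u \<noteq> [] \<longleftrightarrow>
    words.cyclic (snd u) \<and> u = word_path Q (snd u)"
proof (cases "snd u = []")
  case False
  then have "hd (snd u) \<in> set (snd u)" "last (snd u) \<in> set (snd u)" by auto
  with False show ?thesis
    using qpaths_nonempty_iff[OF finite_quiver False, of "fst u"]
    by (cases u) (auto simp: words.cyclic_def word_path_def path_target_nonempty path_source_def composable_def)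
qed (simp add: words.cyclic_def)

lemma subpath_cycle_power_iff:
  assumes "words.cyclic w" "r \<in> R" "p > 0"
  shows "subpath Q r (cycle_power (word_path Q w) p) \<longleftrightarrow> sublist (snd r) (concat (replicate p w))"
proof -
  have w: "w \<noteq> []" "set w \<subseteq> arcs Q" "successively (composable Q) w" "composable Q (last w) (hd w)"
    using assms(1) by (auto simp: words.cyclic_def)
  obtain q where q: "p = Suc q" using assms(3) by (cases p) auto
  have "concat (replicate p w) \<noteq> []" "hd (concat (replicate p w)) = hd w" using w(1) by (simp_all add: q)
  moreover have "set (concat (replicate p w)) \<subseteq> arcs Q" using w(2) by (auto simp: set_replicate_conv_if)
  ultimately have "cycle_power (word_path Q w) p \<in> qpaths Q"
    using successively_power[OF w(1,3,4), of p]
    by (simp add: cycle_power_def word_path_def qpaths_nonempty_iff[OF finite_quiver])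
  from subpath_iff_sublist[OF finite_quiver this subsetD[OF relations(1) assms(2)] relation_nonempty[OF assms(2)]]
  show ?thesis by (simp add: cycle_power_def word_path_def)
qed

lemma cycle_condition_iff:
  assumes r: "r \<in> R"
  shows "(\<exists>u\<in>qpaths Q. path_target Q u = path_source u \<and>
        R \<inter> {w. \<exists>p>0. subpath Q w (cycle_power u p)} = {r}) \<longleftrightarrow>
    (\<exists>u. words.cyclic u \<and> {r' \<in> snd ` R. \<exists>p>0. sublist r' (concat (replicate p u))} = {snd r})"
proof -
  have set_eq: "R \<inter> {w. \<exists>p>0. subpath Q w (cycle_power (word_path Q u) p)} = {r} \<longleftrightarrow>
      {r' \<in> snd ` R. \<exists>p>0. sublist r' (concat (replicate p u))} = {snd r}" if u: "words.cyclic u" for u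
  proof -
    let ?X = "R \<inter> {w. \<exists>p>0. subpath Q w (cycle_power (word_path Q u) p)}"
    have "{r' \<in> snd ` R. \<exists>p>0. sublist r' (concat (replicate p u))} = snd ` ?X"
      using subpath_cycle_power_iff[OF u] by blast
    \<comment> \<open>Relations are nonempty paths, so forgetting the start vertex is injective on
      \<open>R\<close> and the two set equations are equivalent.\<close>
    moreover have "snd ` ?X = snd ` {r} \<longleftrightarrow> ?X = {r}"
    proof (rule inj_on_image_eq_iff)
      show "inj_on snd R" using relation_eq_iff by (blast intro: inj_onI)
    qed (use r in auto)
    ultimately show ?thesis by simp
  qed
  show ?thesis
  proof
    assume "\<exists>u\<in>qpaths Q. path_target Q u = path_source u \<and>
        R \<inter> {w. \<exists>p>0. subpath Q w (cycle_power u p)} = {r}"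
    then obtain u where u: "u \<in> qpaths Q" "path_target Q u = path_source u"
      "R \<inter> {w. \<exists>p>0. subpath Q w (cycle_power u p)} = {r}" by blast
    then obtain p where "subpath Q r (cycle_power u p)" by blast
    \<comment> \<open>A trivial \<open>u\<close> has only trivial powers, which contain no relation;
      hence the cycle is a nonempty word.\<close>
    from subpath_imp_sublist[OF this] have "snd u \<noteq> []"
      using relation_nonempty[OF r] by (auto simp: cycle_power_def)
    then have c: "words.cyclic (snd u)" "u = word_path Q (snd u)"
      using u cyclic_word_path_iff by blast+
    have "R \<inter> {w. \<exists>p>0. subpath Q w (cycle_power (word_path Q (snd u)) p)} = {r}"
      by (subst c(2)[symmetric]) (rule u(3))
    with set_eq[OF c(1)] c(1) show "\<exists>u. words.cyclic u \<and>
        {r' \<in> snd ` R. \<exists>p>0. sublist r' (concat (replicate p u))} = {snd r}" by blast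
  next
    assume "\<exists>u. words.cyclic u \<and> {r' \<in> snd ` R. \<exists>p>0. sublist r' (concat (replicate p u))} = {snd r}"
    then obtain u where u: "words.cyclic u"
      "{r' \<in> snd ` R. \<exists>p>0. sublist r' (concat (replicate p u))} = {snd r}" by blast
    have "word_path Q u \<in> qpaths Q" "path_target Q (word_path Q u) = path_source (word_path Q u)"
      using cyclic_word_path_iff[of "word_path Q u"] u(1) by (auto simp: word_path_def)
    with set_eq[OF u(1)] u(2) show "\<exists>u\<in>qpaths Q. path_target Q u = path_source u \<and>
        R \<inter> {w. \<exists>p>0. subpath Q w (cycle_power u p)} = {r}" by blast
  qed
qed

end

theorem corollary4p1:
  fixes Q :: "('v, 'e) pre_digraph"
    and I :: "(('v, 'e) qpath \<Rightarrow>\<^sub>0 'k::alg_closed_field) set"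
    and R :: "('v, 'e) qpath set"
  assumes "fin_digraph Q"
    and "Digraph_Component.connected Q"
    and "admissible Q I"
    and "special_multiserial Q I"
    and "monomial Q I"
    and "minimal_zero_relations Q I R"
  shows "UMP Q I \<longleftrightarrow>
    (\<forall>r\<in>R. path_length r > 2 \<longrightarrow>
      (\<exists>u\<in>qpaths Q. path_target Q u = path_source u \<and>
        R \<inter> {w. \<exists>p>0. subpath Q w (cycle_power u p)} = {r}))"
proof -
  interpret monomial_quiver_algebra Q I R
    by (rule monomial_quiver_algebra.intro) (fact assms)+
  show ?thesis
    unfolding UMP_iff words.unique_maximal_iff_cyclic_power
    by (auto simp: cycle_condition_iff path_length_def)
qed

end
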